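(* Let $\mathcal{G}=(\mathbf{V},\mathbf{E})$ be a DAG with observable variables $\mathbf{N}\subseteq\mathbf{V}$, and let $\mathcal{C}\subseteq\Lambda_{\mathcal{G}}$ and $\mathbf{T},\mathbf{S}\subseteq\mathbf{N}\setminus\mathcal{C}$ be three disjoint subsets, where $\Lambda_{\mathcal{G}}$ is the set of observed variables having no parents in $\mathcal{G}$. Suppose that the label set $\mathcal{L}_{\mathcal{C}}=(\mathcal{L}_{\mathcal{C}}(\mathbf{c}):\mathbf{c}\in D_{\mathcal{C}})$ is maximal-regular with respect to $\mathcal{G}$. Then the causal effect of $\mathbf{T}$ on $\mathbf{S}$ is identifiable from $(\mathcal{G},\mathcal{L}_{\mathcal{C}})$ if and only if, for every $\mathbf{c}\in D_{\mathcal{C}}$, the causal effect of $\mathbf{T}$ on $\mathbf{S}$ is identifiable from the DAG $\mathcal{G}_{\mathbf{c}}=(\mathbf{V}',\mathbf{E}'\setminus\mathcal{L}_{\mathcal{C}}(\mathbf{c}))$, where $\mathbf{V}'=\mathbf{V}\setminus\mathcal{C}$ and $\mathbf{E}'=\mathbf{E}\cap(\mathbf{V}'\times\mathbf{V}')$ (the observable variables of $\mathcal{G}_{\mathbf{c}}$ being $\mathbf{N}\setminus\mathcal{C}$).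
   Context: Variables. All variables are discrete with finite domains; $D_{\mathbf{X}}$ denotes the domain of a set of variables $\mathbf{X}$. The vertex set is $\mathbf{V}=\mathbf{N}\cup\mathbf{U}$ with $\mathbf{N}$ observable and $\mathbf{U}$ unobservable variables. $Pa_X$ is the set of parents of $X$ in $\mathcal{G}$ ($Y\in Pa_X$ iff $(Y,X)\in\mathbf{E}$). A root is a vertex with no parents; $\Lambda_{\mathcal{G}}$ is the set of observed roots. The set of control variables is a set $\mathcal{C}\subseteq\Lambda_{\mathcal{G}}$. For $X\in\mathbf{V}$, $\mathcal{C}^X:=Pa_X\cap\mathcal{C}$, and for $\mathbf{c}\in D_{\mathcal{C}}$, $\mathbf{c}^X$ is the restriction of $\mathbf{c}$ to $\mathcal{C}^X$. SEM. A structural equation model (SEM) $\mathcal{M}$ with causal graph $\mathcal{G}$ generates each $X\in\mathbf{V}$ as $X=f_X(Pa_X,\epsilon_X)$, with $f_X$ deterministic and the noise variables $\epsilon_X$ jointly independent. $P^{\mathcal{M}}$ is the induced joint distribution. The intervention $do(\mathbf{T}=\mathbf{t})$ forces $\mathbf{T}$ to equal $\mathbf{t}$ and eliminates the influence of other variables on $\mathbf{T}$; $P^{\mathcal{M}}_{\mathbf{t}}(\mathbf{s}):=P^{\mathcal{M}}(\mathbf{S}=\mathbf{s}\mid do(\mathbf{T}=\mathbf{t}))$ is the resulting post-interventional distribution (the causal effect of $\mathbf{T}$ on $\mathbf{S}$). Label sets. For $\mathbf{c}\in D_{\mathcal{C}}$, $\mathcal{L}_{\mathcal{C}}(\mathbf{c})$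 is a set of edges $(Y,X)\in\mathbf{E}$ (with $X,Y\notin\mathcal{C}$) such that $X$ is independent of $Y$ given $\mathcal{C}=\mathbf{c}$ and $\mathbf{S}$, for some $\mathbf{S}\subseteq\mathbf{V}\setminus(\{X,Y\}\cup\mathcal{C})$; and $\mathcal{L}_{\mathcal{C}}:=(\mathcal{L}_{\mathcal{C}}(\mathbf{c}):\mathbf{c}\in D_{\mathcal{C}})$. A SEM $\mathcal{M}$ is compatible with $\mathcal{L}_{\mathcal{C}}$ if for every $\mathbf{c}$ and every $(Y,X)\in\mathcal{L}_{\mathcal{C}}(\mathbf{c})$, $X$ is no longer a function of $Y$ when $\mathcal{C}=\mathbf{c}$ (i.e. $f_X$ does not depend on its argument $Y$ once $\mathcal{C}$ is set to $\mathbf{c}$). We write $(Y,X)\in\mathcal{L}_{\mathcal{C}}$ if $(Y,X)\in\mathcal{L}_{\mathcal{C}}(\mathbf{c})$ for some $\mathbf{c}$. Maximal-regular. $\mathcal{L}_{\mathcal{C}}$ is regular w.r.t. $\mathcal{G}$ if $\mathcal{C}^X\neq\varnothing$ for every $(Y,X)\in\mathcal{L}_{\mathcal{C}}$. It is maximal w.r.t. $\mathcal{G}$ if no label can be added by the following rule: if $(Y,X)\in\mathcal{L}_{\mathcal{C}}(\mathbf{c}_1)$ and $\mathbf{c}_2\neq\mathbf{c}_1$ with $\mathbf{c}_1^X=\mathbf{c}_2^X$, add $(Y,X)$ to $\mathcal{L}_{\mathcal{C}}(\mathbf{c}_2)$; i.e. whenever $\mathbf{c}_1^X=\mathbf{c}_2^X$,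 $(Y,X)\in\mathcal{L}_{\mathcal{C}}(\mathbf{c}_1)$ implies $(Y,X)\in\mathcal{L}_{\mathcal{C}}(\mathbf{c}_2)$. It is maximal-regular if it is both maximal and regular. Identifiability. The causal effect of $\mathbf{T}$ on $\mathbf{S}$ is identifiable from a DAG $\mathcal{G}$ (with observable variables $\mathbf{N}$) if for any $\mathbf{t}\in D_{\mathbf{T}}$, $\mathbf{s}\in D_{\mathbf{S}}$, $P^{\mathcal{M}}_{\mathbf{t}}(\mathbf{s})$ is uniquely computable from $P^{\mathcal{M}}(\mathbf{N})$ in any SEM $\mathcal{M}$ with causal graph $\mathcal{G}$ such that $P^{\mathcal{M}}(\mathbf{n})>0$ for all $\mathbf{n}\in D_{\mathbf{N}}$. For disjoint $\mathbf{T},\mathbf{S}\subseteq\mathbf{N}\setminus\mathcal{C}$, it is identifiable from $(\mathcal{G},\mathcal{L}_{\mathcal{C}})$ if for any $\mathbf{t}\in D_{\mathbf{T}}$, $\mathbf{s}\in D_{\mathbf{S}}$, $P^{\mathcal{M}}_{\mathbf{t}}(\mathbf{s})$ is uniquely computable from $P^{\mathcal{M}}(\mathbf{N})$ in any SEM $\mathcal{M}$ with causal graph $\mathcal{G}$ and compatible with $\mathcal{L}_{\mathcal{C}}$ such that $P^{\mathcal{M}}(\mathbf{n})>0$ for all $\mathbf{n}\in D_{\mathbf{N}}$. "Uniquely computable" means that there exists a continuous operator $\mathcal{F}$ (the same for all the SEMs considered) such that $\mathcal{F}(P^{\mathcal{M}}(\mathbf{N}))=P^{\mathcal{M}}_{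\mathbf{t}}(\mathbf{s})$.
   Formalization: For (G, L_C), F must be continuous also at distributions giving some contexts C=c probability 0 (and positive given every other context), since with continuity only on positive distributions the "only if" direction fails; noise variables are real-valued. *)

theory Defs
  imports "HOL-Probability.Probability"
begin

section \<open>Causal graphs\<close>

text \<open>
  A variable \<^term>\<open>X\<close> takes its values in \<^term>\<open>D X\<close>, so the domain of a set of variables
  \<^term>\<open>A\<close> is \<^term>\<open>PiE A D\<close>. An edge from \<^term>\<open>Y\<close> to \<^term>\<open>X\<close> is the pair \<^term>\<open>(Y, X)\<close>.
\<close>

definition dag :: "'v set \<Rightarrow> ('v \<times> 'v) set \<Rightarrow> bool" where
  "dag V E \<longleftrightarrow> finite V \<and> E \<subseteq> V \<times> V \<and> acyclic E"

definition parents :: "('v \<times> 'v) set \<Rightarrow> 'v \<Rightarrow> 'v set" where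
  "parents E X = {Y. (Y, X) \<in> E}"

definition observed_roots :: "('v \<times> 'v) set \<Rightarrow> 'v set \<Rightarrow> 'v set" where
  "observed_roots E N = {X \<in> N. parents E X = {}}"

definition control_parents :: "('v \<times> 'v) set \<Rightarrow> 'v set \<Rightarrow> 'v \<Rightarrow> 'v set" where
  "control_parents E C X = parents E X \<inter> C"

section \<open>Structural equation models\<close>

text \<open>
  The noise variables are real-valued with arbitrary Borel laws \<^term>\<open>noise M X\<close>. They are jointly
  independent because their joint law is taken to be the product measure
  \<^term>\<open>PiM V (noise M)\<close>.
\<close>

record ('v, 'a) sem =
  noise :: "'v \<Rightarrow> real measure"
  mech :: "'v \<Rightarrow> ('v \<Rightarrow> 'a) \<Rightarrow> real \<Rightarrow> 'a"

definition is_sem ::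
  "'v set \<Rightarrow> ('v \<times> 'v) set \<Rightarrow> ('v \<Rightarrow> 'a set) \<Rightarrow> ('v, 'a) sem \<Rightarrow> bool" where
  "is_sem V E D M \<longleftrightarrow>
     (\<forall>X\<in>V. prob_space (noise M X) \<and> sets (noise M X) = sets borel \<and>
        (\<forall>p \<in> PiE (parents E X) D. mech M X p \<in> noise M X \<rightarrow>\<^sub>M count_space (D X)))"

text \<open>
  The values of all variables under the intervention that sets \<^term>\<open>T\<close> to \<^term>\<open>t\<close>, when the
  noise takes the value \<^term>\<open>e\<close>; they are unique by acyclicity.
\<close>

definition solution ::
  "'v set \<Rightarrow> ('v \<times> 'v) set \<Rightarrow> ('v \<Rightarrow> 'a set) \<Rightarrow> ('v, 'a) sem \<Rightarrow> 'v set \<Rightarrow> ('v \<Rightarrow> 'a) \<Rightarrow>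
   ('v \<Rightarrow> real) \<Rightarrow> 'v \<Rightarrow> 'a" where
  "solution V E D M T t e =
     (THE v. v \<in> PiE V D \<and>
        (\<forall>X\<in>V. v X = (if X \<in> T then t X else mech M X (restrict v (parents E X)) (e X))))"

definition do_law ::
  "'v set \<Rightarrow> ('v \<times> 'v) set \<Rightarrow> ('v \<Rightarrow> 'a set) \<Rightarrow> ('v, 'a) sem \<Rightarrow> 'v set \<Rightarrow> ('v \<Rightarrow> 'a) \<Rightarrow>
   ('v \<Rightarrow> 'a) measure" where
  "do_law V E D M T t =
     distr (PiM V (noise M)) (count_space (PiE V D)) (solution V E D M T t)"

abbreviation obs_law ::
  "'v set \<Rightarrow> ('v \<times> 'v) set \<Rightarrow> ('v \<Rightarrow> 'a set) \<Rightarrow> ('v, 'a) sem \<Rightarrow> ('v \<Rightarrow> 'a) measure" where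
  "obs_law V E D M \<equiv> do_law V E D M {} undefined"

definition causal_effect ::
  "'v set \<Rightarrow> ('v \<times> 'v) set \<Rightarrow> ('v \<Rightarrow> 'a set) \<Rightarrow> ('v, 'a) sem \<Rightarrow> 'v set \<Rightarrow> ('v \<Rightarrow> 'a) \<Rightarrow>
   'v set \<Rightarrow> ('v \<Rightarrow> 'a) \<Rightarrow> real" where
  "causal_effect V E D M T t S s = \<P>(v in do_law V E D M T t. \<forall>X\<in>S. v X = s X)"

definition obs_dist ::
  "'v set \<Rightarrow> ('v \<times> 'v) set \<Rightarrow> ('v \<Rightarrow> 'a set) \<Rightarrow> ('v, 'a) sem \<Rightarrow> 'v set \<Rightarrow> ('v \<Rightarrow> 'a) \<Rightarrow> real" where
  "obs_dist V E D M N = (\<lambda>n \<in> PiE N D. \<P>(v in obs_law V E D M. \<forall>X\<in>N. v X = n X))"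

section \<open>Label sets\<close>

definition compatible ::
  "('v \<times> 'v) set \<Rightarrow> ('v \<Rightarrow> 'a set) \<Rightarrow> 'v set \<Rightarrow> (('v \<Rightarrow> 'a) \<Rightarrow> ('v \<times> 'v) set) \<Rightarrow> ('v, 'a) sem \<Rightarrow> bool"
  where
  "compatible E D C L M \<longleftrightarrow>
     (\<forall>c \<in> PiE C D. \<forall>(Y, X) \<in> L c. \<forall>p \<in> PiE (parents E X) D.
        (\<forall>Z \<in> control_parents E C X. p Z = c Z) \<longrightarrow>
        (\<forall>y \<in> D Y. \<forall>e. mech M X (p(Y := y)) e = mech M X p e))"

definition context_indep ::
  "'v set \<Rightarrow> ('v \<times> 'v) set \<Rightarrow> ('v \<Rightarrow> 'a set) \<Rightarrow> ('v, 'a) sem \<Rightarrow> 'v set \<Rightarrow> ('v \<Rightarrow> 'a) \<Rightarrow>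
   'v \<Rightarrow> 'v \<Rightarrow> 'v set \<Rightarrow> bool" where
  "context_indep V E D M C c X Y S \<longleftrightarrow>
     (\<forall>x \<in> D X. \<forall>y \<in> D Y. \<forall>s \<in> PiE S D.
        \<P>(v in obs_law V E D M. v X = x \<and> v Y = y \<bar> (\<forall>Z\<in>C. v Z = c Z) \<and> (\<forall>Z\<in>S. v Z = s Z)) =
        \<P>(v in obs_law V E D M. v X = x \<bar> (\<forall>Z\<in>C. v Z = c Z) \<and> (\<forall>Z\<in>S. v Z = s Z)) *
        \<P>(v in obs_law V E D M. v Y = y \<bar> (\<forall>Z\<in>C. v Z = c Z) \<and> (\<forall>Z\<in>S. v Z = s Z)))"

text \<open>
  The independence behind a label is a property of the models that carry the labels. For a DAG with
  control variables among the roots it holds in every compatible model, with the set of parents of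
  \<^term>\<open>X\<close> other than \<^term>\<open>Y\<close> and the control variables as \<^term>\<open>S\<close>, so the last clause excludes no
  family of edge sets.
\<close>

definition label_set ::
  "'v set \<Rightarrow> ('v \<times> 'v) set \<Rightarrow> ('v \<Rightarrow> 'a set) \<Rightarrow> 'v set \<Rightarrow> (('v \<Rightarrow> 'a) \<Rightarrow> ('v \<times> 'v) set) \<Rightarrow> bool"
  where
  "label_set V E D C L \<longleftrightarrow>
     (\<forall>c \<in> PiE C D. L c \<subseteq> E \<and>
        (\<forall>(Y, X) \<in> L c. X \<notin> C \<and> Y \<notin> C \<and>
           (\<forall>M. is_sem V E D M \<and> compatible E D C L M \<longrightarrow>
              (\<exists>S. S \<subseteq> V - ({X, Y} \<union> C) \<and> context_indep V E D M C c X Y S))))"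

definition regular_labels ::
  "('v \<times> 'v) set \<Rightarrow> ('v \<Rightarrow> 'a set) \<Rightarrow> 'v set \<Rightarrow> (('v \<Rightarrow> 'a) \<Rightarrow> ('v \<times> 'v) set) \<Rightarrow> bool" where
  "regular_labels E D C L \<longleftrightarrow>
     (\<forall>c \<in> PiE C D. \<forall>(Y, X) \<in> L c. control_parents E C X \<noteq> {})"

definition maximal_labels ::
  "('v \<times> 'v) set \<Rightarrow> ('v \<Rightarrow> 'a set) \<Rightarrow> 'v set \<Rightarrow> (('v \<Rightarrow> 'a) \<Rightarrow> ('v \<times> 'v) set) \<Rightarrow> bool" where
  "maximal_labels E D C L \<longleftrightarrow>
     (\<forall>c1 \<in> PiE C D. \<forall>c2 \<in> PiE C D. \<forall>(Y, X) \<in> L c1.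
        restrict c1 (control_parents E C X) = restrict c2 (control_parents E C X) \<longrightarrow>
        (Y, X) \<in> L c2)"

definition maximal_regular ::
  "('v \<times> 'v) set \<Rightarrow> ('v \<Rightarrow> 'a set) \<Rightarrow> 'v set \<Rightarrow> (('v \<Rightarrow> 'a) \<Rightarrow> ('v \<times> 'v) set) \<Rightarrow> bool" where
  "maximal_regular E D C L \<longleftrightarrow> maximal_labels E D C L \<and> regular_labels E D C L"

section \<open>Identifiability\<close>

definition distributions :: "'v set \<Rightarrow> ('v \<Rightarrow> 'a set) \<Rightarrow> (('v \<Rightarrow> 'a) \<Rightarrow> real) set" where
  "distributions N D =
     {Q \<in> extensional (PiE N D). (\<forall>n \<in> PiE N D. Q n \<ge> 0) \<and> (\<Sum>n \<in> PiE N D. Q n) = 1}"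

definition positive_distributions :: "'v set \<Rightarrow> ('v \<Rightarrow> 'a set) \<Rightarrow> (('v \<Rightarrow> 'a) \<Rightarrow> real) set" where
  "positive_distributions N D = {Q \<in> distributions N D. \<forall>n \<in> PiE N D. Q n > 0}"

text \<open>
  The distributions that are positive given every context of positive probability. The marginal of
  \<^term>\<open>C\<close> is unrestricted, so it may be concentrated on a single context; for \<^term>\<open>C = {}\<close> this
  is \<^term>\<open>positive_distributions N D\<close>.
\<close>

definition context_positive_distributions ::
  "'v set \<Rightarrow> ('v \<Rightarrow> 'a set) \<Rightarrow> 'v set \<Rightarrow> (('v \<Rightarrow> 'a) \<Rightarrow> real) set" where
  "context_positive_distributions N D C =
     {Q \<in> distributions N D. \<forall>n \<in> PiE N D.
        (\<Sum>m \<in> {m \<in> PiE N D. restrict m C = restrict n C}. Q m) > 0 \<longrightarrow> Q n > 0}"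

definition identifiable ::
  "'v set \<Rightarrow> ('v \<times> 'v) set \<Rightarrow> 'v set \<Rightarrow> ('v \<Rightarrow> 'a set) \<Rightarrow> 'v set \<Rightarrow> 'v set \<Rightarrow> bool" where
  "identifiable V E N D T S \<longleftrightarrow>
     (\<forall>t \<in> PiE T D. \<forall>s \<in> PiE S D. \<exists>F.
        continuous_on (positive_distributions N D) F \<and>
        (\<forall>M. is_sem V E D M \<and> (\<forall>n \<in> PiE N D. obs_dist V E D M N n > 0) \<longrightarrow>
           F (obs_dist V E D M N) = causal_effect V E D M T t S s))"

text \<open>
  The models have a positive observational distribution, but the operator has to be continuous also
  where contexts have probability zero. This is what allows one to let the probability of
  one context tend to 1. With continuity on \<^term>\<open>positive_distributions N D\<close> only,
  identifiability from the labelled graph would not imply identifiability in every context. For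
  instance, let \<open>C \<rightarrow> T\<close>, \<open>T \<rightarrow> S\<close>, \<open>U \<rightarrow> T\<close> and \<open>U \<rightarrow> S\<close> with binary variables, \<open>U\<close> unobserved,
  and let \<open>U \<rightarrow> T\<close> be labelled for \<open>C = 0\<close> only: then \<open>P(s | t, C = 0)\<close> is the causal effect, and it
  is not identifiable from the graph of \<open>C = 1\<close>.
\<close>

definition identifiable_labelled ::
  "'v set \<Rightarrow> ('v \<times> 'v) set \<Rightarrow> 'v set \<Rightarrow> ('v \<Rightarrow> 'a set) \<Rightarrow> 'v set \<Rightarrow>
   (('v \<Rightarrow> 'a) \<Rightarrow> ('v \<times> 'v) set) \<Rightarrow> 'v set \<Rightarrow> 'v set \<Rightarrow> bool" where
  "identifiable_labelled V E N D C L T S \<longleftrightarrow>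
     (\<forall>t \<in> PiE T D. \<forall>s \<in> PiE S D. \<exists>F.
        continuous_on (context_positive_distributions N D C) F \<and>
        (\<forall>M. is_sem V E D M \<and> compatible E D C L M \<and>
             (\<forall>n \<in> PiE N D. obs_dist V E D M N n > 0) \<longrightarrow>
           F (obs_dist V E D M N) = causal_effect V E D M T t S s))"

end

theory Submission
  imports Defs
begin

text \<open>
  By the truncated factorization, the law of a model is a finite sum of products of the kernels
  \<open>P (f_X (p, e_X) = x)\<close>. The control variables are roots outside \<open>T\<close>, so the law of a compatible
  model is the mixture, over the contexts \<open>c\<close>, of the laws of models on \<open>G_c\<close>.

  If every context has an operator \<open>F_c\<close>, then \<open>\<Sum>c. Q(c) F_c(Q(\<cdot>|c))\<close> is an operator for the labelled
  graph; truncating \<open>F_c\<close> to \<open>[0, 1]\<close> makes it continuous where \<open>Q(c) = 0\<close>.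

  Conversely, by maximality a model on \<open>G_c\<close> extends to compatible models with positive observational
  distribution in which the context \<open>c\<close> has probability close to 1. Letting this probability tend
  to 1, continuity gives an operator for \<open>G_c\<close>.
\<close>

section \<open>Truncated factorization\<close>

text \<open>The obstacle in the converse is that the extended model must be positive in every
  context and yet respect the labels exactly. The noise of the given model may be degenerate, so its
  own mechanisms cannot be relied on to spread the values in other contexts. Hence only its kernels
  are kept, and every mechanism is resampled from uniform noise. Compatibility, however, is an
  equality of mechanisms at each noise value and not merely of their laws, so the resampling has to
  be a fixed function of the kernel.

  Nor can the contexts other than the given one be filled in independently. A mechanism sees a
  context only through the control parents of its variable, so a variable whose control parents
  happen to agree with the given context must behave there as in that context. The decision between
  the given kernel and the uniform one is therefore taken variable by variable.\<close>

definition mech_law :: "('v, 'a) sem \<Rightarrow> 'v \<Rightarrow> ('v \<Rightarrow> 'a) \<Rightarrow> 'a \<Rightarrow> real" where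
  "mech_law M X p x = measure (noise M X) {e. mech M X p e = x}"

text \<open>The kernels are not tied to a model. Observation is the case \<open>T = {}\<close>, and
  the converse uses such sums for \<open>switched_kernel\<close> with no model on the context graph
  behind them.\<close>

definition factor_sum ::
  "'v set \<Rightarrow> ('v \<times> 'v) set \<Rightarrow> ('v \<Rightarrow> 'a set) \<Rightarrow> ('v \<Rightarrow> ('v \<Rightarrow> 'a) \<Rightarrow> 'a \<Rightarrow> real) \<Rightarrow>
   'v set \<Rightarrow> ('v \<Rightarrow> 'a) \<Rightarrow> 'v set \<Rightarrow> ('v \<Rightarrow> 'a) \<Rightarrow> real" where
  "factor_sum V E D K T t A a =
     (\<Sum>v \<in> {v \<in> PiE V D. (\<forall>X\<in>T. v X = t X) \<and> (\<forall>X\<in>A. v X = a X)}.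
        \<Prod>X\<in>V - T. K X (restrict v (parents E X)) (v X))"

section \<open>Solutions of the structural equations and their law\<close>

lemma dag_wf: "dag V E \<Longrightarrow> wf E"
  unfolding dag_def by (meson finite_SigmaI finite_acyclic_wf finite_subset)

lemma parents_subset: "dag V E \<Longrightarrow> parents E X \<subseteq> V"
  unfolding dag_def parents_def by auto

lemma restrict_parents_PiE:
  "dag V E \<Longrightarrow> v \<in> PiE V D \<Longrightarrow> restrict v (parents E X) \<in> PiE (parents E X) D"
  using parents_subset[of V E X] by (auto simp: PiE_iff)

lemma space_noise: "is_sem V E D M \<Longrightarrow> X \<in> V \<Longrightarrow> space (noise M X) = UNIV"
  unfolding is_sem_def by (metis sets_eq_imp_space_eq space_borel)

lemma mech_in_domain:
  assumes "is_sem V E D M" "X \<in> V" "p \<in> PiE (parents E X) D"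
  shows "mech M X p e \<in> D X"
proof -
  have "mech M X p \<in> noise M X \<rightarrow>\<^sub>M count_space (D X)"
    using assms unfolding is_sem_def by auto
  from measurable_space[OF this] show ?thesis
    using space_noise[OF assms(1,2)] by simp
qed

text \<open>Edges point from parents to children, so well-foundedness of \<open>E\<close> gives
  existence by recursion over the parents and uniqueness by induction over them.\<close>

lemma ex1_solution:
  assumes dag: "dag V E" and sem: "is_sem V E D M" and t: "\<forall>X\<in>T. t X \<in> D X"
  shows "\<exists>!v. v \<in> PiE V D \<and>
    (\<forall>X\<in>V. v X = (if X \<in> T then t X else mech M X (restrict v (parents E X)) (e X)))"
proof (rule ex_ex1I)
  \<comment> \<open>The value \<open>undefined\<close> off \<open>V\<close> makes the recursive
    assignment extensional.\<close>
  define F where "F f X = (if X \<in> V then if X \<in> T then t X else mech M X f (e X) else undefined)"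
    for f X
  define w where "w = wfrec E F"
  \<comment> \<open>\<open>wfrec\<close> passes on \<open>w\<close> cut to the predecessors of
    \<open>X\<close>, which is the same function as its restriction to the parents.\<close>
  have "w X = F (restrict w (parents E X)) X" for X
    unfolding w_def by (subst wfrec[OF dag_wf[OF dag]]) (simp add: cut_def restrict_def parents_def)
  then have w: "w X = (if X \<in> T then t X else mech M X (restrict w (parents E X)) (e X))"
    if "X \<in> V" for X using that by (simp add: F_def)
  have undef: "w X = undefined" if "X \<notin> V" for X
    using that \<open>\<And>X. w X = F (restrict w (parents E X)) X\<close> by (simp add: F_def)
  have "X \<in> V \<longrightarrow> w X \<in> D X" for X
  proof (induction X rule: wf_induct_rule[OF dag_wf[OF dag]])
    case (1 X)
    then have "restrict w (parents E X) \<in> PiE (parents E X) D"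
      using parents_subset[OF dag] by (auto simp: parents_def)
    then show ?case
      using t mech_in_domain[OF sem] by (simp add: w)
  qed
  with undef have "w \<in> PiE V D"
    by (auto simp: PiE_iff extensional_def)
  with w show "\<exists>v. v \<in> PiE V D \<and>
    (\<forall>X\<in>V. v X = (if X \<in> T then t X else mech M X (restrict v (parents E X)) (e X)))"
    by blast
next
  fix v w
  assume v: "v \<in> PiE V D \<and>
      (\<forall>X\<in>V. v X = (if X \<in> T then t X else mech M X (restrict v (parents E X)) (e X)))"
    and w: "w \<in> PiE V D \<and>
      (\<forall>X\<in>V. w X = (if X \<in> T then t X else mech M X (restrict w (parents E X)) (e X)))"
  have "X \<in> V \<longrightarrow> v X = w X" for X
  proof (induction X rule: wf_induct_rule[OF dag_wf[OF dag]])
    case (1 X)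
    then have "restrict v (parents E X) = restrict w (parents E X)"
      using parents_subset[OF dag] by (intro restrict_ext) (auto simp: parents_def)
    moreover have "X \<in> V \<Longrightarrow> v X = (if X \<in> T then t X else mech M X (restrict v (parents E X)) (e X))"
      and "X \<in> V \<Longrightarrow> w X = (if X \<in> T then t X else mech M X (restrict w (parents E X)) (e X))"
      using v w by blast+
    ultimately show ?case
      by simp
  qed
  then show "v = w"
    using v w by (intro PiE_ext[of v V D w]) simp_all
qed

lemma
  assumes "dag V E" "is_sem V E D M" "\<forall>X\<in>T. t X \<in> D X"
  shows solution_PiE: "solution V E D M T t e \<in> PiE V D"
    and solution_eq_iff: "v \<in> PiE V D \<Longrightarrow> solution V E D M T t e = v \<longleftrightarrow>
      (\<forall>X\<in>V. v X = (if X \<in> T then t X else mech M X (restrict v (parents E X)) (e X)))"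
proof -
  note * = ex1_solution[OF assms, of e]
  show "solution V E D M T t e \<in> PiE V D"
    using theI'[OF *] unfolding solution_def by blast
  show "solution V E D M T t e = v \<longleftrightarrow>
      (\<forall>X\<in>V. v X = (if X \<in> T then t X else mech M X (restrict v (parents E X)) (e X)))"
    if "v \<in> PiE V D"
  proof
    assume "solution V E D M T t e = v"
    then show "\<forall>X\<in>V. v X = (if X \<in> T then t X else mech M X (restrict v (parents E X)) (e X))"
      using theI'[OF *] unfolding solution_def by blast
  next
    assume "\<forall>X\<in>V. v X = (if X \<in> T then t X else mech M X (restrict v (parents E X)) (e X))"
    with that show "solution V E D M T t e = v"
      unfolding solution_def by (intro the1_equality[OF *]) blast
  qed
qed

text \<open>The noise values that produce \<open>v\<close> form a box: once \<open>v\<close> is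
  fixed, the equation of each variable concerns its own noise only. Independence turns the box into
  a product. A variable in \<open>T\<close> contributes the whole line or the empty set.\<close>

lemma
  assumes dag: "dag V E" and sem: "is_sem V E D M" and D: "\<forall>X\<in>V. finite (D X)"
    and t: "\<forall>X\<in>T. t X \<in> D X" and T: "T \<subseteq> V"
  shows prob_space_do_law: "prob_space (do_law V E D M T t)"
    and measure_do_law_singleton: "v \<in> PiE V D \<Longrightarrow> measure (do_law V E D M T t) {v} =
      (if \<forall>X\<in>T. v X = t X then \<Prod>X\<in>V - T. mech_law M X (restrict v (parents E X)) (v X) else 0)"
proof -
  have V: "finite V"
    using dag by (simp add: dag_def)
  \<comment> \<open>The product measure locales speak of all indices, whereas \<^term>\<open>noise M\<close> is arbitrary off \<^term>\<open>V\<close>.\<close>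
  define \<nu> where "\<nu> X = (if X \<in> V then noise M X else return borel 0)" for X
  have PiM: "PiM V (noise M) = PiM V \<nu>"
    by (rule PiM_cong) (auto simp: \<nu>_def)
  interpret product_prob_space \<nu> V
    by (rule product_prob_spaceI)
      (use sem in \<open>auto simp: \<nu>_def is_sem_def intro: prob_space_return\<close>)
  interpret finite_product_prob_space \<nu> V
    by standard (rule V)
  define B where "B v X = {e. v X = (if X \<in> T then t X else mech M X (restrict v (parents E X)) e)}"
    for v X
  have space: "space (PiM V \<nu>) = PiE V (\<lambda>_. UNIV)"
    using space_noise[OF sem] by (auto simp: space_PiM \<nu>_def PiE_def)
  have pre: "solution V E D M T t -` {v} \<inter> space (PiM V \<nu>) = PiE V (B v)" if "v \<in> PiE V D" for v
  proof -
    have "solution V E D M T t e = v \<longleftrightarrow> (\<forall>X\<in>V. e X \<in> B v X)" for e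
      unfolding B_def mem_Collect_eq by (rule solution_eq_iff[OF dag sem t that])
    then show ?thesis
      by (auto simp: space PiE_iff)
  qed
  have B: "B v X \<in> sets (\<nu> X)" if "v \<in> PiE V D" "X \<in> V" for v X
  proof (cases "X \<in> T")
    case True
    then show ?thesis
      using sem that(2) by (cases "v X = t X") (auto simp: B_def \<nu>_def is_sem_def)
  next
    case False
    have "mech M X (restrict v (parents E X)) \<in> noise M X \<rightarrow>\<^sub>M count_space (D X)"
      using sem that restrict_parents_PiE[OF dag that(1)] unfolding is_sem_def by auto
    then have "mech M X (restrict v (parents E X)) -` {v X} \<inter> space (noise M X) \<in> sets (noise M X)"
      by (rule measurable_sets) (use that in auto)
    also have "mech M X (restrict v (parents E X)) -` {v X} \<inter> space (noise M X) = B v X"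
      using space_noise[OF sem that(2)] False by (auto simp: B_def)
    finally show ?thesis
      using that(2) by (simp add: \<nu>_def)
  qed
  have meas: "solution V E D M T t \<in> PiM V \<nu> \<rightarrow>\<^sub>M count_space (PiE V D)"
    using B solution_PiE[OF dag sem t]
    by (auto simp: measurable_count_space_eq2 V D finite_PiE pre intro!: sets_PiM_I_finite)
  show "prob_space (do_law V E D M T t)"
    unfolding do_law_def PiM using meas by (rule prob_space_distr)
  assume v: "v \<in> PiE V D"
  have "measure (do_law V E D M T t) {v} = measure (PiM V \<nu>) (PiE V (B v))"
    unfolding do_law_def PiM using meas v by (simp add: measure_distr pre)
  also have "\<dots> = (\<Prod>X\<in>V. measure (\<nu> X) (B v X))"
    by (rule prob_times) (rule B[OF v])
  also have "\<dots> = (\<Prod>X\<in>T. measure (\<nu> X) (B v X)) * (\<Prod>X\<in>V - T. measure (\<nu> X) (B v X))"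
    using prod.subset_diff[OF T V] by (simp add: mult.commute)
  also have "(\<Prod>X\<in>V - T. measure (\<nu> X) (B v X)) =
      (\<Prod>X\<in>V - T. mech_law M X (restrict v (parents E X)) (v X))"
    by (rule prod.cong) (auto simp: \<nu>_def B_def mech_law_def eq_commute)
  also have "(\<Prod>X\<in>T. measure (\<nu> X) (B v X)) = (\<Prod>X\<in>T. if v X = t X then 1 else 0)"
  proof (rule prod.cong)
    fix X assume X: "X \<in> T"
    then have "B v X = (if v X = t X then space (\<nu> X) else {})"
      using T space_noise[OF sem] by (auto simp: B_def \<nu>_def)
    then show "measure (\<nu> X) (B v X) = (if v X = t X then 1 else 0)"
      using M.prob_space by simp
  qed simp
  also have "\<dots> = (if \<forall>X\<in>T. v X = t X then 1 else 0)"
    using finite_subset[OF T V] by (auto intro!: prod.neutral)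
  finally show "measure (do_law V E D M T t) {v} =
      (if \<forall>X\<in>T. v X = t X then \<Prod>X\<in>V - T. mech_law M X (restrict v (parents E X)) (v X) else 0)"
    by (auto simp: restrict_def)
qed

section \<open>Causal effects and observational distributions as factor sums\<close>

lemma space_do_law [simp]: "space (do_law V E D M T t) = PiE V D"
  and sets_do_law [simp]: "sets (do_law V E D M T t) = Pow (PiE V D)"
  by (simp_all add: do_law_def)

lemma causal_effect_eq_factor_sum:
  assumes dag: "dag V E" and sem: "is_sem V E D M" and D: "\<forall>X\<in>V. finite (D X)"
    and t: "\<forall>X\<in>T. t X \<in> D X" and T: "T \<subseteq> V"
  shows "causal_effect V E D M T t S s = factor_sum V E D (mech_law M) T t S s"
proof -
  interpret prob_space "do_law V E D M T t"
    by (rule prob_space_do_law[OF assms])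
  have fin: "finite (PiE V D)"
    using dag D by (auto simp: dag_def intro: finite_PiE)
  have "causal_effect V E D M T t S s =
      measure (do_law V E D M T t) {v \<in> PiE V D. \<forall>X\<in>S. v X = s X}"
    by (simp add: causal_effect_def)
  also have "\<dots> = (\<Sum>v \<in> {v \<in> PiE V D. \<forall>X\<in>S. v X = s X}. measure (do_law V E D M T t) {v})"
    by (rule finite_measure_eq_sum_singleton) (auto simp: fin)
  also have "\<dots> = factor_sum V E D (mech_law M) T t S s"
    unfolding factor_sum_def
    using fin
    by (intro sum.mono_neutral_cong_right) (auto simp: measure_do_law_singleton[OF assms])
  finally show ?thesis .
qed

lemma obs_dist_eq_factor_sum:
  assumes "dag V E" "is_sem V E D M" "\<forall>X\<in>V. finite (D X)" "n \<in> PiE N D"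
  shows "obs_dist V E D M N n = factor_sum V E D (mech_law M) {} undefined N n"
  using causal_effect_eq_factor_sum[OF assms(1-3), of "{}" undefined N n] assms(4)
  by (simp add: obs_dist_def causal_effect_def)

lemma causal_effect_bounds:
  assumes "dag V E" "is_sem V E D M" "\<forall>X\<in>V. finite (D X)"
    "\<forall>X\<in>T. t X \<in> D X" "T \<subseteq> V"
  shows "0 \<le> causal_effect V E D M T t S s" "causal_effect V E D M T t S s \<le> 1"
proof -
  interpret prob_space "do_law V E D M T t"
    by (rule prob_space_do_law[OF assms])
  show "0 \<le> causal_effect V E D M T t S s" "causal_effect V E D M T t S s \<le> 1"
    by (simp_all add: causal_effect_def)
qed

lemma obs_dist_distribution:
  assumes dag: "dag V E" and sem: "is_sem V E D M" and D: "\<forall>X\<in>V. finite (D X)"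
    and N: "N \<subseteq> V"
  shows "obs_dist V E D M N \<in> distributions N D"
proof -
  interpret prob_space "obs_law V E D M"
    by (rule prob_space_do_law[OF dag sem D]) auto
  have fin: "finite (PiE N D)"
    using dag D N by (auto simp: dag_def intro!: finite_PiE intro: finite_subset)
  have "(\<Sum>n \<in> PiE N D. obs_dist V E D M N n) =
      (\<Sum>n \<in> PiE N D. prob {v \<in> PiE V D. \<forall>X\<in>N. v X = n X})"
    by (simp add: obs_dist_def)
  also have "\<dots> = prob (\<Union>n \<in> PiE N D. {v \<in> PiE V D. \<forall>X\<in>N. v X = n X})"
  proof (rule finite_measure_finite_Union[symmetric, OF fin])
    show "disjoint_family_on (\<lambda>n. {v \<in> PiE V D. \<forall>X\<in>N. v X = n X}) (PiE N D)"
      unfolding disjoint_family_on_def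
    proof (intro ballI impI equals0I)
      fix m n v
      assume "m \<in> PiE N D" "n \<in> PiE N D" "m \<noteq> n"
        and "v \<in> {v \<in> PiE V D. \<forall>X\<in>N. v X = m X} \<inter> {v \<in> PiE V D. \<forall>X\<in>N. v X = n X}"
      then show False
        using PiE_ext[of m N D n] by auto
    qed
  qed auto
  also have "(\<Union>n \<in> PiE N D. {v \<in> PiE V D. \<forall>X\<in>N. v X = n X}) = PiE V D"
  proof -
    have "v \<in> (\<Union>n \<in> PiE N D. {v \<in> PiE V D. \<forall>X\<in>N. v X = n X})" if "v \<in> PiE V D" for v
      using that N by (intro UN_I[of "restrict v N"]) (auto simp: PiE_iff)
    then show ?thesis
      by blast
  qed
  also have "prob (PiE V D) = 1"
    using prob_space by simp
  finally show ?thesis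
    by (auto simp: distributions_def obs_dist_def)
qed

section \<open>Models with prescribed kernels\<close>

text \<open>The open unit interval is the domain of the quantile function used for sampling; the
  push-forward to the whole line is there because \<open>is_sem\<close> asks for noise on
  \<open>borel\<close>.\<close>

definition uniform_noise :: "real measure" where
  "uniform_noise = distr (restrict_space lborel {0<..<1}) borel (\<lambda>x. x)"

lemma prob_space_uniform_noise: "prob_space uniform_noise"
  unfolding uniform_noise_def
  by (intro prob_space.prob_space_distr prob_spaceI measurable_restrict_space1)
    (auto simp: emeasure_restrict_space space_restrict_space)

lemma sets_uniform_noise [simp]: "sets uniform_noise = sets borel"
  by (simp add: uniform_noise_def)

lemma space_uniform_noise [simp]: "space uniform_noise = UNIV"
  by (simp add: uniform_noise_def)

text \<open>Inverse transform sampling: the elements of \<open>A\<close> are coded as reals, the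
  quantile function \<open>I\<close> of the coded law is applied to uniform noise, and the result is
  decoded.\<close>

lemma ex_sampler:
  fixes q :: "'a \<Rightarrow> real"
  assumes A: "finite A" and q: "\<And>a. a \<in> A \<Longrightarrow> 0 \<le> q a" "(\<Sum>a\<in>A. q a) = 1"
  shows "\<exists>f. f \<in> uniform_noise \<rightarrow>\<^sub>M count_space A \<and>
    (\<forall>a\<in>A. measure uniform_noise {e. f e = a} = q a)"
proof -
  define p where "p = embed_pmf (\<lambda>a. if a \<in> A then q a else 0)"
  have "(\<integral>\<^sup>+ a. ennreal (if a \<in> A then q a else 0) \<partial>count_space UNIV) = 1"
  proof -
    have "(\<integral>\<^sup>+ a. ennreal (if a \<in> A then q a else 0) \<partial>count_space UNIV) =
        (\<Sum>a\<in>A. ennreal (if a \<in> A then q a else 0))"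
      by (rule nn_integral_count_space') (use A in auto)
    also have "\<dots> = ennreal (\<Sum>a\<in>A. q a)"
      using q(1) by simp
    finally show ?thesis
      by (simp add: q(2))
  qed
  then have p: "pmf p a = (if a \<in> A then q a else 0)" for a
    unfolding p_def by (intro pmf_embed_pmf) (use q(1) in auto)
  define enc :: "'a \<Rightarrow> real" where "enc a = real (to_nat_on A a)" for a
  have inj: "inj_on enc A"
    using inj_on_to_nat_on[OF countable_finite[OF A]] by (auto simp: inj_on_def enc_def)
  define \<mu> where "\<mu> = distr (measure_pmf p) borel enc"
  have "real_distribution \<mu>"
    unfolding \<mu>_def real_distribution_def real_distribution_axioms_def
    by (auto intro: measure_pmf.prob_space_distr)
  then interpret cdf_distribution \<mu>
    by (simp add: cdf_distribution_def)
  \<comment> \<open>\<open>a0\<close> is the default for reals that code nothing and for noise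
    outside the unit interval.\<close>
  obtain a0 where a0: "a0 \<in> A"
    using q(2) by fastforce
  define dec where "dec y = (if y \<in> enc ` A then the_inv_into A enc y else a0)" for y
  have dec: "dec (enc a) = a" if "a \<in> A" for a
    using that inj by (simp add: dec_def the_inv_into_f_f)
  have decA: "dec y \<in> A" for y
    using inj a0 by (auto simp: dec_def the_inv_into_f_f)
  have dec_measurable: "dec \<in> borel \<rightarrow>\<^sub>M count_space A"
    unfolding measurable_count_space_eq2[OF A]
  proof safe
    fix a assume "a \<in> A"
    then have "dec -` {a} = {enc a} \<union> (if a = a0 then - (enc ` A) else {})"
      using inj a0 by (auto simp: dec_def the_inv_into_f_f split: if_splits)
    moreover have "{enc a} \<in> sets borel" "- (enc ` A) \<in> sets borel"
      using A by (auto intro!: borel_closed borel_open finite_imp_closed)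
    ultimately show "dec -` {a} \<inter> space borel \<in> sets borel"
      by auto
  qed (rule decA)
  define f where "f e = (if e \<in> {0<..<1} then dec (I e) else a0)" for e
  have "(\<lambda>e. dec (I e)) \<in> restrict_space borel {0<..<1} \<rightarrow>\<^sub>M count_space A"
    by (rule measurable_compose[OF measurable_CI dec_measurable])
  then have "f \<in> borel \<rightarrow>\<^sub>M count_space A"
    unfolding f_def using a0 by (subst (asm) measurable_restrict_space_iff[where c = a0]) auto
  then have f: "f \<in> uniform_noise \<rightarrow>\<^sub>M count_space A"
    by (simp add: measurable_cong_sets[OF sets_uniform_noise refl])
  have level: "{e. f e = a} \<in> sets borel" if "a \<in> A" for a
    using measurable_sets[OF f, of "{a}"] that by (simp add: vimage_def)
  interpret U: prob_space uniform_noise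
    by (rule prob_space_uniform_noise)
  \<comment> \<open>An inequality is enough, since both sides sum to 1 over \<open>A\<close>. It
    avoids determining the level set of \<open>a0\<close>, which is enlarged by the
    defaults.\<close>
  have q_le: "q a \<le> U.prob {e. f e = a}" if a: "a \<in> A" for a
  proof -
    let ?\<Omega> = "restrict_space lborel {0<..<1::real}"
    interpret \<Omega>: prob_space ?\<Omega>
      by (rule prob_spaceI) (auto simp: emeasure_restrict_space space_restrict_space)
    have I: "I \<in> ?\<Omega> \<rightarrow>\<^sub>M borel"
      using measurable_CI by (simp add: measurable_def space_restrict_space sets_restrict_space)
    have id: "(\<lambda>x. x) \<in> ?\<Omega> \<rightarrow>\<^sub>M borel"
      by (rule measurable_restrict_space1) simp
    have "q a = measure_pmf.prob p {a}"
      using a by (simp add: measure_pmf_single p)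
    also have "\<dots> \<le> measure_pmf.prob p (enc -` {enc a})"
      by (rule measure_pmf.finite_measure_mono) auto
    also have "\<dots> = measure \<mu> {enc a}"
      by (simp add: \<mu>_def measure_distr)
    also have "\<dots> = \<Omega>.prob (I -` {enc a} \<inter> space ?\<Omega>)"
      by (subst distr_I_eq_M[symmetric]) (simp add: measure_distr[OF I])
    also have "\<dots> \<le> \<Omega>.prob ((\<lambda>x. x) -` {e. f e = a} \<inter> space ?\<Omega>)"
      using measurable_sets[OF id level[OF a]]
      by (intro \<Omega>.finite_measure_mono) (auto simp: f_def dec[OF a] space_restrict_space)
    also have "\<dots> = U.prob {e. f e = a}"
      unfolding uniform_noise_def by (rule measure_distr[OF id level[OF a], symmetric])
    finally show ?thesis .
  qed
  have "(\<Sum>a\<in>A. U.prob {e. f e = a}) = 1"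
  proof -
    interpret F: prob_space "distr uniform_noise (count_space A) f"
      by (rule U.prob_space_distr[OF f])
    have "(\<Sum>a\<in>A. U.prob {e. f e = a}) = (\<Sum>a\<in>A. F.prob {a})"
      by (rule sum.cong) (auto simp: measure_distr[OF f] vimage_def)
    also have "\<dots> = F.prob A"
      by (rule F.finite_measure_eq_sum_singleton[symmetric]) (use A in auto)
    finally show ?thesis
      using F.prob_space by simp
  qed
  then have "(\<Sum>a\<in>A. U.prob {e. f e = a} - q a) = 0"
    by (simp add: sum_subtractf q(2))
  then have "U.prob {e. f e = a} = q a" if "a \<in> A" for a
    using sum_nonneg_0[OF A _ _ that, of "\<lambda>a. U.prob {e. f e = a} - q a"] q_le by force
  with f show ?thesis
    by blast
qed

definition sampler :: "'a set \<Rightarrow> ('a \<Rightarrow> real) \<Rightarrow> real \<Rightarrow> 'a" where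
  "sampler A q = (SOME f. f \<in> uniform_noise \<rightarrow>\<^sub>M count_space A \<and>
    (\<forall>a\<in>A. measure uniform_noise {e. f e = a} = q a))"

text \<open>
  The mechanism of a variable depends on its parents only through the kernel, so that equal kernels
  give mechanisms that are equal as functions, which is what \<^const>\<open>compatible\<close> asks for.
\<close>

definition kernel_sem ::
  "('v \<Rightarrow> 'a set) \<Rightarrow> ('v \<Rightarrow> ('v \<Rightarrow> 'a) \<Rightarrow> 'a \<Rightarrow> real) \<Rightarrow> ('v, 'a) sem" where
  "kernel_sem D K = \<lparr>noise = \<lambda>_. uniform_noise, mech = \<lambda>X p. sampler (D X) (K X p)\<rparr>"

definition kernel_on ::
  "'v set \<Rightarrow> ('v \<times> 'v) set \<Rightarrow> ('v \<Rightarrow> 'a set) \<Rightarrow> ('v \<Rightarrow> ('v \<Rightarrow> 'a) \<Rightarrow> 'a \<Rightarrow> real) \<Rightarrow> bool" where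
  "kernel_on V E D K \<longleftrightarrow> (\<forall>X\<in>V. \<forall>p \<in> PiE (parents E X) D.
     (\<forall>x\<in>D X. 0 \<le> K X p x) \<and> (\<Sum>x\<in>D X. K X p x) = 1)"

lemma
  assumes "finite A" "\<And>a. a \<in> A \<Longrightarrow> 0 \<le> q a" "(\<Sum>a\<in>A. q a) = 1"
  shows sampler_measurable: "sampler A q \<in> uniform_noise \<rightarrow>\<^sub>M count_space A"
    and measure_sampler: "a \<in> A \<Longrightarrow> measure uniform_noise {e. sampler A q e = a} = q a"
  using someI_ex[OF ex_sampler[of A q]] assms unfolding sampler_def by blast+

lemma is_sem_kernel_sem:
  assumes "kernel_on V E D K" "\<forall>X\<in>V. finite (D X)"
  shows "is_sem V E D (kernel_sem D K)"
  using assms prob_space_uniform_noise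
  by (auto simp: is_sem_def kernel_sem_def kernel_on_def intro!: sampler_measurable)

lemma mech_law_kernel_sem:
  assumes "kernel_on V E D K" "\<forall>X\<in>V. finite (D X)"
    and "X \<in> V" "p \<in> PiE (parents E X) D" "x \<in> D X"
  shows "mech_law (kernel_sem D K) X p x = K X p x"
  using assms by (auto simp: mech_law_def kernel_sem_def kernel_on_def intro!: measure_sampler)

lemma kernel_on_mech_law:
  assumes sem: "is_sem V E D M" and D: "\<forall>X\<in>V. finite (D X)"
  shows "kernel_on V E D (mech_law M)"
  unfolding kernel_on_def
proof (intro ballI conjI)
  fix X p assume X: "X \<in> V" and p: "p \<in> PiE (parents E X) D"
  interpret prob_space "noise M X"
    using sem X by (simp add: is_sem_def)
  have meas: "mech M X p \<in> noise M X \<rightarrow>\<^sub>M count_space (D X)"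
    using sem X p by (simp add: is_sem_def)
  interpret F: prob_space "distr (noise M X) (count_space (D X)) (mech M X p)"
    by (rule prob_space_distr[OF meas])
  have "(\<Sum>x\<in>D X. mech_law M X p x) = (\<Sum>x\<in>D X. F.prob {x})"
    using space_noise[OF sem X]
    by (intro sum.cong) (auto simp: measure_distr[OF meas] mech_law_def vimage_def)
  also have "\<dots> = F.prob (D X)"
    by (rule F.finite_measure_eq_sum_singleton[symmetric]) (use D X in auto)
  finally show "(\<Sum>x\<in>D X. mech_law M X p x) = 1"
    using F.prob_space by simp
qed (simp add: mech_law_def)

section \<open>Fixing the context\<close>

lemma factor_sum_cong:
  assumes dag: "dag V E"
    and "\<And>X p x. X \<in> V - T \<Longrightarrow> p \<in> PiE (parents E X) D \<Longrightarrow> x \<in> D X \<Longrightarrow> K X p x = K' X p x"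
    and "\<And>X. X \<in> A \<Longrightarrow> a X = a' X"
  shows "factor_sum V E D K T t A a = factor_sum V E D K' T t A a'"
  unfolding factor_sum_def
proof (rule sum.cong)
  show "{v \<in> PiE V D. (\<forall>X\<in>T. v X = t X) \<and> (\<forall>X\<in>A. v X = a X)} =
      {v \<in> PiE V D. (\<forall>X\<in>T. v X = t X) \<and> (\<forall>X\<in>A. v X = a' X)}"
    using assms(3) by auto
next
  fix v assume "v \<in> {v \<in> PiE V D. (\<forall>X\<in>T. v X = t X) \<and> (\<forall>X\<in>A. v X = a' X)}"
  then have v: "v \<in> PiE V D"
    by simp
  show "(\<Prod>X\<in>V - T. K X (restrict v (parents E X)) (v X)) =
      (\<Prod>X\<in>V - T. K' X (restrict v (parents E X)) (v X))"
    using v restrict_parents_PiE[OF dag v] by (intro prod.cong assms(2)) auto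
qed

lemma override_on_PiE:
  assumes "C \<subseteq> N" "c \<in> PiE C D" "m \<in> PiE (N - C) D"
  shows "override_on m c C \<in> PiE N D"
  using assms by (auto simp: PiE_iff override_on_def extensional_def)

lemma sum_context:
  assumes C: "C \<subseteq> N" and c: "c \<in> PiE C D"
  shows "(\<Sum>n \<in> {n \<in> PiE N D. restrict n C = c}. f n) =
    (\<Sum>m \<in> PiE (N - C) D. f (override_on m c C))"
proof (rule sum.reindex_bij_witness[where i = "\<lambda>m. override_on m c C"
      and j = "\<lambda>n. restrict n (N - C)"])
  fix n assume n: "n \<in> {n \<in> PiE N D. restrict n C = c}"
  then have "c = restrict n C"
    by simp
  then show eq: "override_on (restrict n (N - C)) c C = n"
    using n by (auto simp: override_on_def PiE_iff extensional_def fun_eq_iff)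
  show "restrict n (N - C) \<in> PiE (N - C) D"
    using n by (auto simp: PiE_iff)
  show "f (override_on (restrict n (N - C)) c C) = f n"
    by (simp add: eq)
next
  fix m assume m: "m \<in> PiE (N - C) D"
  show "restrict (override_on m c C) (N - C) = m"
    using m by (auto simp: override_on_def PiE_iff extensional_def fun_eq_iff)
  have "restrict (override_on m c C) C = c"
    using c by (auto simp: override_on_def PiE_iff extensional_def fun_eq_iff)
  then show "override_on m c C \<in> {n \<in> PiE N D. restrict n C = c}"
    using override_on_PiE[OF C c m] by simp
qed

lemma factor_sum_fixed_context:
  assumes dag: "dag V E" and C: "C \<subseteq> V" and roots: "\<And>X. X \<in> C \<Longrightarrow> parents E X = {}"
    and T: "T \<subseteq> V - C" and A: "A \<subseteq> V - C" and b: "\<And>X. X \<in> C \<Longrightarrow> b X \<in> D X"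
    and E': "E' \<subseteq> (V - C) \<times> (V - C)"
    and K: "\<And>v X. v \<in> PiE V D \<Longrightarrow> (\<And>Z. Z \<in> C \<Longrightarrow> v Z = b Z) \<Longrightarrow> X \<in> V - C \<Longrightarrow>
      K X (restrict v (parents E X)) (v X) = K' X (restrict v (parents E' X)) (v X)"
  shows "factor_sum V E D K T t (C \<union> A) b =
    (\<Prod>X\<in>C. K X (\<lambda>_. undefined) (b X)) * factor_sum (V - C) E' D K' T t A b"
  unfolding factor_sum_def sum_distrib_left
proof (rule sum.reindex_bij_witness[where i = "\<lambda>m. override_on m b C"
      and j = "\<lambda>n. restrict n (V - C)"])
  fix v assume v: "v \<in> {v \<in> PiE V D. (\<forall>X\<in>T. v X = t X) \<and> (\<forall>X\<in>C \<union> A. v X = b X)}"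
  then show "override_on (restrict v (V - C)) b C = v"
    by (auto simp: override_on_def PiE_iff extensional_def fun_eq_iff)
  show "restrict v (V - C) \<in>
      {v \<in> PiE (V - C) D. (\<forall>X\<in>T. v X = t X) \<and> (\<forall>X\<in>A. v X = b X)}"
    using v T A by (auto simp: PiE_iff)
  have fin: "finite V"
    using dag by (simp add: dag_def)
  have par: "parents E' X \<subseteq> V - C" for X
    using E' by (auto simp: parents_def)
  have "(\<Prod>X\<in>V - T. K X (restrict v (parents E X)) (v X)) =
      (\<Prod>X\<in>C \<union> (V - C - T). K X (restrict v (parents E X)) (v X))"
    using C T by (intro prod.cong) auto
  also have "\<dots> = (\<Prod>X\<in>C. K X (restrict v (parents E X)) (v X)) *
      (\<Prod>X\<in>V - C - T. K X (restrict v (parents E X)) (v X))"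
    using fin C by (intro prod.union_disjoint) (auto intro: finite_subset)
  \<comment> \<open>A root has the empty parent set, and restriction to it is the function that is
    \<open>undefined\<close> everywhere.\<close>
  also have "(\<Prod>X\<in>C. K X (restrict v (parents E X)) (v X)) =
      (\<Prod>X\<in>C. K X (\<lambda>_. undefined) (b X))"
    using v by (intro prod.cong) (auto simp: roots restrict_def)
  also have "(\<Prod>X\<in>V - C - T. K X (restrict v (parents E X)) (v X)) =
      (\<Prod>X\<in>V - C - T. K' X (restrict (restrict v (V - C)) (parents E' X)) (restrict v (V - C) X))"
    using v K by (intro prod.cong) (auto simp: Int_absorb1[OF par])
  finally show "(\<Prod>X\<in>C. K X (\<lambda>_. undefined) (b X)) *
      (\<Prod>X\<in>V - C - T. K' X (restrict (restrict v (V - C)) (parents E' X)) (restrict v (V - C) X)) =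
      (\<Prod>X\<in>V - T. K X (restrict v (parents E X)) (v X))"
    by (rule sym)
next
  fix m assume m: "m \<in> {v \<in> PiE (V - C) D. (\<forall>X\<in>T. v X = t X) \<and> (\<forall>X\<in>A. v X = b X)}"
  then show "restrict (override_on m b C) (V - C) = m"
    by (auto simp: override_on_def PiE_iff extensional_def fun_eq_iff)
  have "override_on m b C \<in> PiE V D"
    using m C b by (auto simp: PiE_iff override_on_def extensional_def)
  then show "override_on m b C \<in> {v \<in> PiE V D. (\<forall>X\<in>T. v X = t X) \<and> (\<forall>X\<in>C \<union> A. v X = b X)}"
    using m T A by (auto simp: override_on_def)
qed

lemma factor_sum_split_context:
  assumes dag: "dag V E" and C: "C \<subseteq> V" and D: "\<forall>X\<in>V. finite (D X)" and S: "S \<inter> C = {}"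
  shows "factor_sum V E D K T t S s =
    (\<Sum>c \<in> PiE C D. factor_sum V E D K T t (C \<union> S) (override_on s c C))"
proof -
  have fin: "finite (PiE V D)" "finite (PiE C D)"
    using dag D C by (auto simp: dag_def intro!: finite_PiE intro: finite_subset)
  let ?A = "\<lambda>c. {v \<in> PiE V D. (\<forall>X\<in>T. v X = t X) \<and> (\<forall>X\<in>C \<union> S. v X = override_on s c C X)}"
  have "{v \<in> PiE V D. (\<forall>X\<in>T. v X = t X) \<and> (\<forall>X\<in>S. v X = s X)} = (\<Union>c \<in> PiE C D. ?A c)"
  proof (intro equalityI subsetI)
    fix v assume "v \<in> {v \<in> PiE V D. (\<forall>X\<in>T. v X = t X) \<and> (\<forall>X\<in>S. v X = s X)}"
    then show "v \<in> (\<Union>c \<in> PiE C D. ?A c)"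
      using C by (intro UN_I[of "restrict v C"]) (auto simp: PiE_iff override_on_def)
  next
    fix v assume "v \<in> (\<Union>c \<in> PiE C D. ?A c)"
    then show "v \<in> {v \<in> PiE V D. (\<forall>X\<in>T. v X = t X) \<and> (\<forall>X\<in>S. v X = s X)}"
      using S by (auto simp: override_on_def)
  qed
  moreover have "?A c \<inter> ?A c' = {}" if "c \<in> PiE C D" "c' \<in> PiE C D" "c \<noteq> c'" for c c'
    using that PiE_ext[OF that(1,2)] by (auto simp: override_on_def)
  ultimately show ?thesis
    unfolding factor_sum_def using fin by (simp add: sum.UNION_disjoint)
qed

section \<open>The model of a context\<close>

text \<open>\<open>compatible\<close> permits changing one labelled parent at a time; induction over
  the finite set \<open>B\<close> of changed parents handles them together. As \<open>B\<close>
  avoids \<open>C\<close>, every intermediate assignment stays in the context.\<close>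

lemma compatible_mech_eq:
  assumes comp: "compatible E D C L M" and c: "c \<in> PiE C D" and B: "finite B"
    and "B \<subseteq> {Y. (Y, X) \<in> L c} \<inter> parents E X - C"
    and "p \<in> PiE (parents E X) D" "p' \<in> PiE (parents E X) D"
    and "\<forall>Z\<in>control_parents E C X. p Z = c Z" and "\<forall>Z. Z \<notin> B \<longrightarrow> p' Z = p Z"
  shows "mech M X p' e = mech M X p e"
  using B assms(4-)
proof (induction B arbitrary: p' rule: finite_induct)
  case empty
  then have "p' = p"
    by auto
  then show ?case
    by simp
next
  case (insert Y B)
  have Y: "(Y, X) \<in> L c" "Y \<in> parents E X" "Y \<notin> C" "p Y \<in> D Y"
    using insert.prems by auto
  have "\<forall>Z\<in>control_parents E C X. p' Z = c Z"
    using insert.prems by (auto simp: control_parents_def)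
  \<comment> \<open>Resetting \<open>Y\<close> to its value under \<open>p\<close> leaves an
    assignment that differs from \<open>p\<close> on the smaller set only.\<close>
  then have "mech M X (p'(Y := p Y)) e = mech M X p' e"
    using comp c Y insert.prems(3) unfolding compatible_def by blast
  moreover have "mech M X (p'(Y := p Y)) e = mech M X p e"
    using insert.prems Y by (intro insert.IH) (auto simp: PiE_iff extensional_def)
  ultimately show ?case
    by simp
qed

text \<open>A labelled parent is missing in the context graph, so its argument is filled with an
  arbitrary element of its domain; compatibility makes the choice immaterial.\<close>

definition context_sem ::
  "('v \<times> 'v) set \<Rightarrow> ('v \<Rightarrow> 'a set) \<Rightarrow> 'v set \<Rightarrow> (('v \<Rightarrow> 'a) \<Rightarrow> ('v \<times> 'v) set) \<Rightarrow> ('v \<Rightarrow> 'a) \<Rightarrow>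
   ('v, 'a) sem \<Rightarrow> ('v, 'a) sem" where
  "context_sem E D C L c M =
     \<lparr>noise = noise M,
      mech = \<lambda>X p. mech M X (\<lambda>Y\<in>parents E X.
        if Y \<in> C then c Y else if (Y, X) \<in> L c then SOME y. y \<in> D Y else p Y)\<rparr>"

lemma is_sem_context_sem:
  assumes dag: "dag V E" and sem: "is_sem V E D M" and D: "\<forall>X\<in>V. D X \<noteq> {}"
    and c: "c \<in> PiE C D"
  shows "is_sem (V - C) (E \<inter> ((V - C) \<times> (V - C)) - L c) D (context_sem E D C L c M)"
proof -
  have "(\<lambda>Y\<in>parents E X.
        if Y \<in> C then c Y else if (Y, X) \<in> L c then SOME y. y \<in> D Y else p Y) \<in> PiE (parents E X) D"
    if "X \<in> V - C" and p: "p \<in> PiE (parents (E \<inter> ((V - C) \<times> (V - C)) - L c) X) D" for X p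
  proof (intro PiE_I)
    fix Y assume Y: "Y \<in> parents E X"
    then have "Y \<in> V"
      using parents_subset[OF dag] by blast
    then have "(SOME y. y \<in> D Y) \<in> D Y"
      using D by (simp add: some_in_eq)
    moreover have "Y \<in> parents (E \<inter> ((V - C) \<times> (V - C)) - L c) X" if "Y \<notin> C" "(Y, X) \<notin> L c"
      using that Y \<open>X \<in> V - C\<close> \<open>Y \<in> V\<close> by (auto simp: parents_def)
    ultimately show "(\<lambda>Y\<in>parents E X.
        if Y \<in> C then c Y else if (Y, X) \<in> L c then SOME y. y \<in> D Y else p Y) Y \<in> D Y"
      using Y c p by auto
  qed simp
  then show ?thesis
    using sem by (simp add: is_sem_def context_sem_def)
qed

text \<open>In the context \<open>c\<close> the true parent assignment and the filled one differ at
  most in labelled parents, so the mechanisms agree at every noise value.\<close>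

lemma mech_law_context_sem:
  assumes dag: "dag V E" and C: "C \<subseteq> V" and comp: "compatible E D C L M"
    and D: "\<forall>X\<in>V. D X \<noteq> {}" and c: "c \<in> PiE C D"
    and L: "\<And>X Y. (Y, X) \<in> L c \<Longrightarrow> Y \<notin> C"
    and v: "v \<in> PiE V D" "\<And>Z. Z \<in> C \<Longrightarrow> v Z = c Z" and X: "X \<in> V - C"
  shows "mech_law M X (restrict v (parents E X)) x =
    mech_law (context_sem E D C L c M) X
      (restrict v (parents (E \<inter> ((V - C) \<times> (V - C)) - L c) X)) x"
proof -
  let ?E' = "E \<inter> ((V - C) \<times> (V - C)) - L c"
  define p where "p = restrict v (parents E X)"
  define p' where "p' = (\<lambda>Y\<in>parents E X. if Y \<in> C then c Y
    else if (Y, X) \<in> L c then SOME y. y \<in> D Y else restrict v (parents ?E' X) Y)"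
  have p: "p \<in> PiE (parents E X) D"
    unfolding p_def by (rule restrict_parents_PiE[OF dag v(1)])
  have eq: "p' Y = p Y" if "(Y, X) \<notin> L c \<or> Y \<notin> parents E X" for Y
    using that v X L parents_subset[OF dag, of X]
    by (auto simp: p_def p'_def parents_def)
  have "p' \<in> PiE (parents E X) D"
  proof (rule PiE_I)
    fix Y assume Y: "Y \<in> parents E X"
    show "p' Y \<in> D Y"
    proof (cases "(Y, X) \<in> L c")
      case True
      have "D Y \<noteq> {}"
        using Y D parents_subset[OF dag] by blast
      then show ?thesis
        using True Y L by (auto simp: p'_def some_in_eq)
    next
      case False
      then show ?thesis
        using p Y by (auto simp: eq)
    qed
  qed (simp add: p'_def)
  moreover have "finite (parents E X)"
    using dag parents_subset[OF dag, of X] by (auto simp: dag_def intro: finite_subset)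
  ultimately have "mech M X p' e = mech M X p e" for e
    using p v(2) eq L
    by (intro compatible_mech_eq[OF comp c, of "{Y. (Y, X) \<in> L c} \<inter> parents E X"])
      (auto simp: p_def control_parents_def)
  then show ?thesis
    by (simp add: mech_law_def context_sem_def p_def p'_def)
qed

section \<open>Continuity\<close>

text \<open>At a zero of \<open>w\<close> the bound on \<open>h\<close> squeezes the product to 0.
  Elsewhere \<open>h\<close> is continuous, because positivity of \<open>w\<close> persists
  nearby.\<close>

lemma continuous_on_mult_bounded:
  fixes w h :: "'x::topological_space \<Rightarrow> real"
  assumes w: "continuous_on A w" "\<And>x. x \<in> A \<Longrightarrow> 0 \<le> w x"
    and h: "continuous_on {x \<in> A. 0 < w x} h" "\<And>x. \<bar>h x\<bar> \<le> B"
  shows "continuous_on A (\<lambda>x. w x * h x)"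
  unfolding continuous_on_def
proof
  fix x assume x: "x \<in> A"
  have wx: "(w \<longlongrightarrow> w x) (at x within A)"
    using w(1) x by (simp add: continuous_on_def)
  show "((\<lambda>x. w x * h x) \<longlongrightarrow> w x * h x) (at x within A)"
  proof (cases "w x = 0")
    case True
    have "((\<lambda>y. \<bar>w y\<bar> * B) \<longlongrightarrow> \<bar>w x\<bar> * B) (at x within A)"
      by (intro tendsto_intros wx)
    then have "((\<lambda>y. \<bar>w y\<bar> * B) \<longlongrightarrow> 0) (at x within A)"
      by (simp add: True)
    then have "((\<lambda>y. w y * h y) \<longlongrightarrow> 0) (at x within A)"
      by (rule Lim_null_comparison[rotated])
        (auto simp: abs_mult intro!: always_eventually mult_left_mono h(2))
    then show ?thesis
      by (simp add: True)
  next
    case False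
    then have "x \<in> {x \<in> A. 0 < w x}"
      using w(2) x by force
    \<comment> \<open>The set where \<open>w\<close> is positive is relatively open in
      \<open>A\<close>, so limits within it and within \<open>A\<close> coincide.\<close>
    moreover obtain U where U: "open U" "U \<inter> A = w -` {0<..} \<inter> A"
      using w(1) unfolding continuous_on_open_invariant by (meson open_greaterThan)
    ultimately have "at x within A = at x within {x \<in> A. 0 < w x}"
      by (intro at_within_nhd[of x U]) auto
    then have "(h \<longlongrightarrow> h x) (at x within A)"
      using h(1) \<open>x \<in> {x \<in> A. 0 < w x}\<close> by (simp add: continuous_on_def)
    then show ?thesis
      by (intro tendsto_mult wx)
  qed
qed

lemma continuous_on_evaluation:
  "continuous_on A (\<lambda>Q::'x \<Rightarrow> 'y::topological_space. Q x)"
  by (rule continuous_on_subset[OF continuous_on_product_coordinates]) simp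

section \<open>The mass of a context and the conditional distribution given it\<close>

definition context_mass ::
  "'v set \<Rightarrow> ('v \<Rightarrow> 'a set) \<Rightarrow> 'v set \<Rightarrow> ('v \<Rightarrow> 'a) \<Rightarrow> (('v \<Rightarrow> 'a) \<Rightarrow> real) \<Rightarrow> real" where
  "context_mass N D C c Q = (\<Sum>m \<in> PiE (N - C) D. Q (override_on m c C))"

definition context_cond ::
  "'v set \<Rightarrow> ('v \<Rightarrow> 'a set) \<Rightarrow> 'v set \<Rightarrow> ('v \<Rightarrow> 'a) \<Rightarrow> (('v \<Rightarrow> 'a) \<Rightarrow> real) \<Rightarrow> ('v \<Rightarrow> 'a) \<Rightarrow> real" where
  "context_cond N D C c Q =
     (\<lambda>m \<in> PiE (N - C) D. Q (override_on m c C) / context_mass N D C c Q)"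

lemma continuous_on_context_mass: "continuous_on A (context_mass N D C c)"
  unfolding context_mass_def by (intro continuous_on_sum continuous_on_evaluation)

lemma continuous_on_context_cond:
  "(\<And>Q. Q \<in> A \<Longrightarrow> 0 < context_mass N D C c Q) \<Longrightarrow> continuous_on A (context_cond N D C c)"
proof (rule continuous_on_coordinatewise_then_product)
  fix m
  assume *: "\<And>Q. Q \<in> A \<Longrightarrow> 0 < context_mass N D C c Q"
  show "continuous_on A (\<lambda>Q. context_cond N D C c Q m)"
  proof (cases "m \<in> PiE (N - C) D")
    case True
    have "continuous_on A (\<lambda>Q. Q (override_on m c C) / context_mass N D C c Q)"
      by (intro continuous_on_divide continuous_on_evaluation continuous_on_context_mass ballI)
        (use * in force)
    with True show ?thesis
      by (simp add: context_cond_def)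
  next
    case False
    then show ?thesis
      by (simp add: context_cond_def)
  qed
qed

lemma context_mass_nonneg:
  assumes "C \<subseteq> N" "c \<in> PiE C D" "Q \<in> distributions N D"
  shows "0 \<le> context_mass N D C c Q"
  using assms override_on_PiE[OF assms(1,2)]
  by (auto simp: context_mass_def distributions_def intro!: sum_nonneg)

text \<open>Context positivity is tailored to this: conditioning on a context of positive mass lands
  where the operator of that context is continuous.\<close>

lemma context_cond_positive:
  assumes C: "C \<subseteq> N" and c: "c \<in> PiE C D" and Q: "Q \<in> context_positive_distributions N D C"
    and pos: "0 < context_mass N D C c Q"
  shows "context_cond N D C c Q \<in> positive_distributions (N - C) D"
proof -
  have "0 < Q (override_on m c C)" if m: "m \<in> PiE (N - C) D" for m
  proof -
    have n: "override_on m c C \<in> PiE N D"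
      by (rule override_on_PiE[OF C c m])
    have "restrict (override_on m c C) C = c"
      using c by (auto simp: override_on_def PiE_iff extensional_def fun_eq_iff)
    then have "(\<Sum>k \<in> {k \<in> PiE N D. restrict k C = restrict (override_on m c C) C}. Q k) > 0"
      using sum_context[OF C c, of Q] pos by (simp add: context_mass_def)
    then show ?thesis
      using Q n by (simp add: context_positive_distributions_def)
  qed
  moreover have "(\<Sum>m \<in> PiE (N - C) D. Q (override_on m c C) / context_mass N D C c Q) = 1"
    using pos by (simp add: context_mass_def flip: sum_divide_distrib)
  ultimately show ?thesis
    using pos by (auto simp: positive_distributions_def distributions_def context_cond_def
        intro!: less_imp_le)
qed

section \<open>Labelled graphs\<close>

locale labelled_graph =
  fixes V N C T S :: "'v set"
    and E :: "('v \<times> 'v) set"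
    and D :: "'v \<Rightarrow> 'a set"
    and L :: "('v \<Rightarrow> 'a) \<Rightarrow> ('v \<times> 'v) set"
  assumes dag: "dag V E"
    and N: "N \<subseteq> V"
    and domain: "\<And>X. X \<in> V \<Longrightarrow> finite (D X) \<and> D X \<noteq> {}"
    and C: "C \<subseteq> observed_roots E N"
    and T: "T \<subseteq> N - C" and S: "S \<subseteq> N - C"
    and L: "\<And>c X Y. c \<in> PiE C D \<Longrightarrow> (Y, X) \<in> L c \<Longrightarrow> (Y, X) \<in> E \<and> X \<notin> C \<and> Y \<notin> C"
    and maximal: "maximal_labels E D C L"
begin

definition context_edges :: "('v \<Rightarrow> 'a) \<Rightarrow> ('v \<times> 'v) set" where
  "context_edges c = E \<inter> ((V - C) \<times> (V - C)) - L c"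

lemma CN: "C \<subseteq> N" and CV: "C \<subseteq> V"
  using C N by (auto simp: observed_roots_def)

lemma roots: "X \<in> C \<Longrightarrow> parents E X = {}"
  using C by (auto simp: observed_roots_def)

lemma TV: "T \<subseteq> V - C" and SV: "S \<subseteq> V - C" and NV: "N - C \<subseteq> V - C"
  using T S N by auto

lemma finite_domain: "\<forall>X\<in>V. finite (D X)" and finite_domain': "\<forall>X\<in>V - C. finite (D X)"
  and domain_nonempty: "\<forall>X\<in>V. D X \<noteq> {}"
  using domain by auto

lemma finite_PiE_N: "finite (PiE N D)" and finite_PiE_C: "finite (PiE C D)"
  using dag N CV domain by (auto simp: dag_def intro!: finite_PiE intro: finite_subset)

lemma dag_context: "dag (V - C) (context_edges c)"
proof -
  have "acyclic (context_edges c)"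
    using dag by (auto simp: dag_def context_edges_def intro: acyclic_subset)
  then show ?thesis
    using dag by (auto simp: dag_def context_edges_def)
qed

lemma context_edges_subset: "context_edges c \<subseteq> (V - C) \<times> (V - C)"
  by (auto simp: context_edges_def)

text \<open>Graph and kernels may vary with the context because both directions use this: one takes
  the graph of each context with the laws of its context model, the other the single graph of
  \<open>c0\<close> with switched kernels in all contexts.\<close>

lemma
  fixes K' :: "('v \<Rightarrow> 'a) \<Rightarrow> 'v \<Rightarrow> ('v \<Rightarrow> 'a) \<Rightarrow> 'a \<Rightarrow> real"
  assumes sem: "is_sem V E D M"
    and E': "\<And>c. E' c \<subseteq> (V - C) \<times> (V - C)"
    and K': "\<And>c v X. c \<in> PiE C D \<Longrightarrow> v \<in> PiE V D \<Longrightarrow> (\<And>Z. Z \<in> C \<Longrightarrow> v Z = c Z) \<Longrightarrow> X \<in> V - C \<Longrightarrow>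
      mech_law M X (restrict v (parents E X)) (v X) = K' c X (restrict v (parents (E' c) X)) (v X)"
  shows obs_dist_mixture: "n \<in> PiE N D \<Longrightarrow> obs_dist V E D M N n =
      (\<Prod>X\<in>C. mech_law M X (\<lambda>_. undefined) (n X)) *
      factor_sum (V - C) (E' (restrict n C)) D (K' (restrict n C)) {} undefined (N - C) n"
    and causal_effect_mixture: "t \<in> PiE T D \<Longrightarrow> causal_effect V E D M T t S s =
      (\<Sum>c \<in> PiE C D. (\<Prod>X\<in>C. mech_law M X (\<lambda>_. undefined) (c X)) *
        factor_sum (V - C) (E' c) D (K' c) T t S s)"
proof -
  assume n: "n \<in> PiE N D"
  have c: "restrict n C \<in> PiE C D"
    using n CN by (auto simp: PiE_iff)
  have "obs_dist V E D M N n = factor_sum V E D (mech_law M) {} undefined (C \<union> (N - C)) n"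
    using CN by (simp add: obs_dist_eq_factor_sum[OF dag sem finite_domain n] Un_absorb1)
  also have "\<dots> = (\<Prod>X\<in>C. mech_law M X (\<lambda>_. undefined) (n X)) *
      factor_sum (V - C) (E' (restrict n C)) D (K' (restrict n C)) {} undefined (N - C) n"
    using n CN by (intro factor_sum_fixed_context[OF dag CV roots _ NV _ E'] K'[OF c]) auto
  finally show "obs_dist V E D M N n =
      (\<Prod>X\<in>C. mech_law M X (\<lambda>_. undefined) (n X)) *
      factor_sum (V - C) (E' (restrict n C)) D (K' (restrict n C)) {} undefined (N - C) n" .
next
  assume t: "t \<in> PiE T D"
  have "causal_effect V E D M T t S s = factor_sum V E D (mech_law M) T t S s"
    using t TV by (intro causal_effect_eq_factor_sum[OF dag sem finite_domain]) auto
  also have "\<dots> = (\<Sum>c \<in> PiE C D. factor_sum V E D (mech_law M) T t (C \<union> S) (override_on s c C))"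
    using SV by (intro factor_sum_split_context[OF dag CV finite_domain]) auto
  also have "\<dots> = (\<Sum>c \<in> PiE C D. (\<Prod>X\<in>C. mech_law M X (\<lambda>_. undefined) (c X)) *
        factor_sum (V - C) (E' c) D (K' c) T t S s)"
  proof (rule sum.cong[OF refl])
    fix c assume c: "c \<in> PiE C D"
    have "factor_sum V E D (mech_law M) T t (C \<union> S) (override_on s c C) =
        (\<Prod>X\<in>C. mech_law M X (\<lambda>_. undefined) (override_on s c C X)) *
        factor_sum (V - C) (E' c) D (K' c) T t S (override_on s c C)"
      using c by (intro factor_sum_fixed_context[OF dag CV roots TV SV _ E'] K'[OF c])
        (auto simp: PiE_iff)
    also have "factor_sum (V - C) (E' c) D (K' c) T t S (override_on s c C) =
        factor_sum (V - C) (E' c) D (K' c) T t S s"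
      using SV by (auto simp: factor_sum_def override_on_def intro!: sum.cong)
    finally show "factor_sum V E D (mech_law M) T t (C \<union> S) (override_on s c C) =
        (\<Prod>X\<in>C. mech_law M X (\<lambda>_. undefined) (c X)) * factor_sum (V - C) (E' c) D (K' c) T t S s"
      by simp
  qed
  finally show "causal_effect V E D M T t S s =
      (\<Sum>c \<in> PiE C D. (\<Prod>X\<in>C. mech_law M X (\<lambda>_. undefined) (c X)) *
        factor_sum (V - C) (E' c) D (K' c) T t S s)" .
qed

subsection \<open>From the contexts to the labelled graph\<close>

text \<open>On the context \<open>c\<close> the observed distribution is a weight times that of the
  context model. The latter sums to 1, so the weight is the mass of \<open>c\<close>; positivity
  makes it nonzero, and dividing by it gives the conditional distribution.\<close>

lemma
  assumes sem: "is_sem V E D M" and comp: "compatible E D C L M"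
    and pos: "\<And>n. n \<in> PiE N D \<Longrightarrow> 0 < obs_dist V E D M N n"
  defines "Mc \<equiv> \<lambda>c. context_sem E D C L c M"
  shows is_sem_context: "c \<in> PiE C D \<Longrightarrow> is_sem (V - C) (context_edges c) D (Mc c)"
    and context_cond_obs_dist: "c \<in> PiE C D \<Longrightarrow>
      context_cond N D C c (obs_dist V E D M N) = obs_dist (V - C) (context_edges c) D (Mc c) (N - C)"
    and obs_dist_context_pos: "c \<in> PiE C D \<Longrightarrow> m \<in> PiE (N - C) D \<Longrightarrow>
      0 < obs_dist (V - C) (context_edges c) D (Mc c) (N - C) m"
    and causal_effect_eq_context_sum: "t \<in> PiE T D \<Longrightarrow> causal_effect V E D M T t S s =
      (\<Sum>c \<in> PiE C D. context_mass N D C c (obs_dist V E D M N) *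
        causal_effect (V - C) (context_edges c) D (Mc c) T t S s)"
proof -
  have semc: "is_sem (V - C) (context_edges c) D (Mc c)" if "c \<in> PiE C D" for c
    unfolding Mc_def context_edges_def
    by (rule is_sem_context_sem[OF dag sem domain_nonempty that])
  have K: "mech_law M X (restrict v (parents E X)) (v X) =
      mech_law (Mc c) X (restrict v (parents (context_edges c) X)) (v X)"
    if "c \<in> PiE C D" "v \<in> PiE V D" "\<And>Z. Z \<in> C \<Longrightarrow> v Z = c Z" "X \<in> V - C" for c v X
    unfolding Mc_def context_edges_def using L[OF that(1)] that
    by (intro mech_law_context_sem[OF dag CV comp domain_nonempty]) auto
  let ?Q = "obs_dist V E D M N"
  let ?w = "\<lambda>c. \<Prod>X\<in>C. mech_law M X (\<lambda>_. undefined) (c X)"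
  let ?R = "\<lambda>c. obs_dist (V - C) (context_edges c) D (Mc c) (N - C)"
  have Q: "?Q (override_on m c C) = ?w c * ?R c m"
    if c: "c \<in> PiE C D" and m: "m \<in> PiE (N - C) D" for c m
  proof -
    have "restrict (override_on m c C) C = c"
      using c by (auto simp: override_on_def PiE_iff extensional_def fun_eq_iff)
    then have "?Q (override_on m c C) = ?w (override_on m c C) *
        factor_sum (V - C) (context_edges c) D (mech_law (Mc c)) {} undefined (N - C) (override_on m c C)"
      using obs_dist_mixture[OF sem context_edges_subset K override_on_PiE[OF CN c m]] by simp
    also have "factor_sum (V - C) (context_edges c) D (mech_law (Mc c)) {} undefined (N - C)
        (override_on m c C) =
        factor_sum (V - C) (context_edges c) D (mech_law (Mc c)) {} undefined (N - C) m"
      by (rule factor_sum_cong[OF dag_context]) (auto simp: override_on_def)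
    also have "\<dots> = ?R c m"
      by (rule obs_dist_eq_factor_sum[OF dag_context semc[OF c] finite_domain' m, symmetric])
    finally show ?thesis
      by simp
  qed
  have mass: "context_mass N D C c ?Q = ?w c" if c: "c \<in> PiE C D" for c
  proof -
    have "context_mass N D C c ?Q = ?w c * (\<Sum>m \<in> PiE (N - C) D. ?R c m)"
      by (simp add: context_mass_def Q[OF c] sum_distrib_left)
    also have "(\<Sum>m \<in> PiE (N - C) D. ?R c m) = 1"
      using obs_dist_distribution[OF dag_context semc[OF c] finite_domain' NV]
      by (simp add: distributions_def)
    finally show ?thesis
      by simp
  qed
  have w_nonneg: "0 \<le> ?w c" for c
    by (intro prod_nonneg) (simp add: mech_law_def)
  {
    fix c assume c: "c \<in> PiE C D"
    show "is_sem (V - C) (context_edges c) D (Mc c)"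
      by (rule semc[OF c])
    show pos_c: "0 < ?R c m" if m: "m \<in> PiE (N - C) D" for m
      using pos[OF override_on_PiE[OF CN c m]] w_nonneg[of c]
      by (auto simp: Q[OF c m] zero_less_mult_iff)
    \<comment> \<open>One configuration, available because domains are nonempty, already shows that
      the weight of \<open>c\<close> is nonzero.\<close>
    have "PiE (N - C) D \<noteq> {}"
      using domain N by (auto simp: PiE_eq_empty_iff)
    then obtain m where m: "m \<in> PiE (N - C) D"
      by blast
    have "?w c \<noteq> 0"
      using pos[OF override_on_PiE[OF CN c m]] by (auto simp: Q[OF c m])
    then have "context_cond N D C c ?Q = restrict (?R c) (PiE (N - C) D)"
      unfolding context_cond_def mass[OF c] by (intro restrict_ext) (simp add: Q[OF c])
    then show "context_cond N D C c ?Q = ?R c"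
      by (simp add: obs_dist_def)
  }
  assume t: "t \<in> PiE T D"
  have "factor_sum (V - C) (context_edges c) D (mech_law (Mc c)) T t S s =
      causal_effect (V - C) (context_edges c) D (Mc c) T t S s" if "c \<in> PiE C D" for c
    using t TV
    by (intro causal_effect_eq_factor_sum[OF dag_context semc[OF that] finite_domain', symmetric]) auto
  then show "causal_effect V E D M T t S s = (\<Sum>c \<in> PiE C D. context_mass N D C c ?Q *
      causal_effect (V - C) (context_edges c) D (Mc c) T t S s)"
    using causal_effect_mixture[OF sem context_edges_subset K t] by (simp add: mass)
qed

text \<open>
  Causal effects lie between 0 and 1, so the operators of the contexts may be truncated to that
  interval. Truncation makes the terms of contexts of vanishing mass tend to 0, although
  the operator of such a context need not have a limit.
\<close>

lemma identifiable_labelled_if_contexts: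
  assumes id: "\<And>c. c \<in> PiE C D \<Longrightarrow> identifiable (V - C) (context_edges c) (N - C) D T S"
  shows "identifiable_labelled V E N D C L T S"
  unfolding identifiable_labelled_def
proof (intro ballI)
  fix t s assume t: "t \<in> PiE T D" and s: "s \<in> PiE S D"
  define ok where "ok c F \<longleftrightarrow> continuous_on (positive_distributions (N - C) D) F \<and>
    (\<forall>M. is_sem (V - C) (context_edges c) D M \<and>
        (\<forall>n \<in> PiE (N - C) D. obs_dist (V - C) (context_edges c) D M (N - C) n > 0) \<longrightarrow>
      F (obs_dist (V - C) (context_edges c) D M (N - C)) =
        causal_effect (V - C) (context_edges c) D M T t S s)" for c F
  have "\<forall>c \<in> PiE C D. \<exists>F. ok c F"
    using id t s unfolding identifiable_def ok_def by blast
  from bchoice[OF this] obtain F where F: "\<forall>c \<in> PiE C D. ok c (F c)" ..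
  have F_cont: "continuous_on (positive_distributions (N - C) D) (F c)" if "c \<in> PiE C D" for c
    using F that unfolding ok_def by simp
  have F_eq: "F c (obs_dist (V - C) (context_edges c) D M (N - C)) =
      causal_effect (V - C) (context_edges c) D M T t S s"
    if "c \<in> PiE C D" "is_sem (V - C) (context_edges c) D M"
      "\<And>n. n \<in> PiE (N - C) D \<Longrightarrow> obs_dist (V - C) (context_edges c) D M (N - C) n > 0" for c M
    using F that unfolding ok_def by simp
  define h where "h c Q = max 0 (min 1 (F c (context_cond N D C c Q)))" for c Q
  define G where "G Q = (\<Sum>c \<in> PiE C D. context_mass N D C c Q * h c Q)" for Q
  have "continuous_on (context_positive_distributions N D C) G"
    unfolding G_def
  proof (rule continuous_on_sum)
    fix c assume c: "c \<in> PiE C D"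
    let ?A = "{Q \<in> context_positive_distributions N D C. 0 < context_mass N D C c Q}"
    have "continuous_on ?A (\<lambda>Q. F c (context_cond N D C c Q))"
      using context_cond_positive[OF CN c]
      by (intro continuous_on_compose2[OF F_cont[OF c] continuous_on_context_cond]) auto
    then have "continuous_on ?A (h c)"
      unfolding h_def by (intro continuous_intros)
    then show "continuous_on (context_positive_distributions N D C)
        (\<lambda>Q. context_mass N D C c Q * h c Q)"
      by (intro continuous_on_mult_bounded[where B = 1] continuous_on_context_mass)
        (auto simp: h_def context_positive_distributions_def intro: context_mass_nonneg[OF CN c])
  qed
  moreover have "G (obs_dist V E D M N) = causal_effect V E D M T t S s"
    if sem: "is_sem V E D M" and comp: "compatible E D C L M"
      and pos: "\<And>n. n \<in> PiE N D \<Longrightarrow> obs_dist V E D M N n > 0" for M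
  proof -
    have "h c (obs_dist V E D M N) =
        causal_effect (V - C) (context_edges c) D (context_sem E D C L c M) T t S s"
      if c: "c \<in> PiE C D" for c
    proof -
      note semc = is_sem_context[OF sem comp pos c]
      have "\<forall>X\<in>T. t X \<in> D X"
        using t by auto
      \<comment> \<open>By these bounds the truncation in \<open>h\<close> does not alter the value
        on an actual model.\<close>
      note bounds = causal_effect_bounds[OF dag_context semc finite_domain' this TV, of S s]
      show ?thesis
        using bounds F_eq[OF c semc obs_dist_context_pos[OF sem comp pos c]]
        by (simp add: h_def context_cond_obs_dist[OF sem comp pos c])
    qed
    then show ?thesis
      by (simp add: G_def causal_effect_eq_context_sum[OF sem comp pos t])
  qed
  ultimately show "\<exists>F. continuous_on (context_positive_distributions N D C) F \<and>
    (\<forall>M. is_sem V E D M \<and> compatible E D C L M \<and> (\<forall>n \<in> PiE N D. 0 < obs_dist V E D M N n) \<longrightarrow>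
      F (obs_dist V E D M N) = causal_effect V E D M T t S s)"
    by blast
qed

subsection \<open>From the labelled graph to the contexts\<close>

text \<open>
  A model of the context \<^term>\<open>c0\<close> extends to kernels on the labelled graph: variables whose control
  parents disagree with \<^term>\<open>c0\<close> become uniform, and the control variables take the
  values of \<^term>\<open>c0\<close> up to an error of probability at most \<^term>\<open>\<epsilon>\<close>. Maximality makes this
  compatible with the labels.
\<close>

definition extended_kernel ::
  "('v \<Rightarrow> 'a) \<Rightarrow> ('v \<Rightarrow> ('v \<Rightarrow> 'a) \<Rightarrow> 'a \<Rightarrow> real) \<Rightarrow> real \<Rightarrow> 'v \<Rightarrow> ('v \<Rightarrow> 'a) \<Rightarrow> 'a \<Rightarrow> real" where
  "extended_kernel c0 K \<epsilon> X p x =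
     (if X \<in> C then (1 - \<epsilon>) * of_bool (x = c0 X) + \<epsilon> / card (D X)
      else if \<forall>Z \<in> control_parents E C X. p Z = c0 Z
      then K X (restrict p (parents (context_edges c0) X)) x else 1 / card (D X))"

text \<open>The form that \<open>extended_kernel\<close> takes in the context \<open>c\<close>. The
  test reads \<open>c\<close> instead of the parents, so for every \<open>c\<close> the kernel lives
  on the graph of \<open>c0\<close>; for \<open>c = c0\<close> it is \<open>K\<close>.\<close>

definition switched_kernel ::
  "('v \<Rightarrow> 'a) \<Rightarrow> ('v \<Rightarrow> ('v \<Rightarrow> 'a) \<Rightarrow> 'a \<Rightarrow> real) \<Rightarrow> ('v \<Rightarrow> 'a) \<Rightarrow> 'v \<Rightarrow> ('v \<Rightarrow> 'a) \<Rightarrow> 'a \<Rightarrow> real" where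
  "switched_kernel c0 K c X p x =
     (if \<forall>Z \<in> control_parents E C X. c Z = c0 Z then K X p x else 1 / card (D X))"

lemma card_domain: "X \<in> V \<Longrightarrow> 0 < card (D X)"
  using domain by (simp add: card_gt_0_iff)

lemma parents_context: "parents (context_edges c) X \<subseteq> parents E X"
  by (auto simp: parents_def context_edges_def)

lemma kernel_on_extended:
  assumes c0: "c0 \<in> PiE C D" and K: "kernel_on (V - C) (context_edges c0) D K"
    and \<epsilon>: "0 \<le> \<epsilon>" "\<epsilon> \<le> 1"
  shows "kernel_on V E D (extended_kernel c0 K \<epsilon>)"
  unfolding kernel_on_def
proof (intro ballI)
  fix X p assume X: "X \<in> V" and p: "p \<in> PiE (parents E X) D"
  have q: "restrict p (parents (context_edges c0) X) \<in> PiE (parents (context_edges c0) X) D"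
    using p parents_context[of c0 X] by (auto simp: PiE_iff)
  show "(\<forall>x\<in>D X. 0 \<le> extended_kernel c0 K \<epsilon> X p x) \<and> (\<Sum>x\<in>D X. extended_kernel c0 K \<epsilon> X p x) = 1"
  proof (cases "X \<in> C")
    case True
    then have "c0 X \<in> D X"
      using c0 by auto
    then have "(\<Sum>x\<in>D X. of_bool (x = c0 X)) = (1::real)"
      using domain[OF X] by (simp add: of_bool_def)
    then show ?thesis
      using True \<epsilon> card_domain[OF X]
      by (simp add: extended_kernel_def sum.distrib flip: sum_distrib_left)
  next
    case False
    show ?thesis
    proof (cases "\<forall>Z \<in> control_parents E C X. p Z = c0 Z")
      case True
      then have "extended_kernel c0 K \<epsilon> X p = K X (restrict p (parents (context_edges c0) X))"
        using False by (simp add: extended_kernel_def fun_eq_iff)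
      then show ?thesis
        using K q X False by (simp add: kernel_on_def)
    next
      case disagree: False
      have "extended_kernel c0 K \<epsilon> X p = (\<lambda>_. 1 / card (D X))"
        unfolding extended_kernel_def fun_eq_iff if_not_P[OF False] if_not_P[OF disagree] by simp
      then show ?thesis
        using card_domain[OF X] by simp
    qed
  qed
qed

text \<open>If the control parents of \<open>X\<close> take their \<open>c0\<close> values,
  maximality carries the label from \<open>c\<close> to \<open>c0\<close>, so \<open>Y\<close> is no
  parent of \<open>X\<close> in the graph of \<open>c0\<close>. Otherwise the kernel is uniform and
  ignores \<open>Y\<close>.\<close>

lemma compatible_extended:
  assumes c0: "c0 \<in> PiE C D"
  shows "compatible E D C L (kernel_sem D (extended_kernel c0 K \<epsilon>))"
  unfolding compatible_def
proof (intro ballI impI allI case_prodI2)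
  fix c YX Y X p y e
  assume c: "c \<in> PiE C D" and YX: "YX \<in> L c" "YX = (Y, X)" and p: "p \<in> PiE (parents E X) D"
    and pc: "\<forall>Z \<in> control_parents E C X. p Z = c Z" and y: "y \<in> D Y"
  have XY: "X \<notin> C" "Y \<notin> C"
    using L[OF c] YX by auto
  have same: "(\<forall>Z \<in> control_parents E C X. (p(Y := y)) Z = c0 Z) \<longleftrightarrow>
      (\<forall>Z \<in> control_parents E C X. p Z = c0 Z)"
    using XY by (auto simp: control_parents_def)
  have "restrict (p(Y := y)) (parents (context_edges c0) X) = restrict p (parents (context_edges c0) X)"
    if agree: "\<forall>Z \<in> control_parents E C X. p Z = c0 Z"
  proof -
    have "restrict c (control_parents E C X) = restrict c0 (control_parents E C X)"
      using agree pc by (intro restrict_ext) simp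
    then have "(Y, X) \<in> L c0"
      using maximal c c0 YX unfolding maximal_labels_def by blast
    then have "Y \<notin> parents (context_edges c0) X"
      by (simp add: parents_def context_edges_def)
    then show ?thesis
      by (intro restrict_ext) auto
  qed
  \<comment> \<open>Equality is needed as functions, also outside \<open>D X\<close>:
    \<open>sampler\<close> is chosen from the entire function.\<close>
  then have "extended_kernel c0 K \<epsilon> X (p(Y := y)) = extended_kernel c0 K \<epsilon> X p"
    unfolding extended_kernel_def same using XY by (intro ext) simp
  then show "mech (kernel_sem D (extended_kernel c0 K \<epsilon>)) X (p(Y := y)) e =
      mech (kernel_sem D (extended_kernel c0 K \<epsilon>)) X p e"
    by (simp add: kernel_sem_def)
qed

lemma extended_kernel_factors:
  assumes v: "v \<in> PiE V D" "\<And>Z. Z \<in> C \<Longrightarrow> v Z = c Z" and X: "X \<in> V - C"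
  shows "extended_kernel c0 K \<epsilon> X (restrict v (parents E X)) x =
    switched_kernel c0 K c X (restrict v (parents (context_edges c0) X)) x"
proof -
  have "(\<forall>Z \<in> control_parents E C X. restrict v (parents E X) Z = c0 Z) \<longleftrightarrow>
      (\<forall>Z \<in> control_parents E C X. c Z = c0 Z)"
    using v by (auto simp: control_parents_def)
  then show ?thesis
    using X by (simp add: extended_kernel_def switched_kernel_def Int_absorb1[OF parents_context])
qed

text \<open>
  Some configuration of the unobserved variables makes all factors of \<^term>\<open>K\<close> positive, and then
  the factors of the switched kernel are positive as well.
\<close>

lemma switched_factor_sum_pos:
  assumes K: "kernel_on (V - C) (context_edges c0) D K"
    and pos: "0 < factor_sum (V - C) (context_edges c0) D K {} u A a"
  shows "0 < factor_sum (V - C) (context_edges c0) D (switched_kernel c0 K c) {} u A a"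
proof -
  let ?G = "context_edges c0"
  let ?W = "{v \<in> PiE (V - C) D. (\<forall>X\<in>{}. v X = u X) \<and> (\<forall>X\<in>A. v X = a X)}"
  let ?f = "\<lambda>K v. \<Prod>X\<in>V - C. K X (restrict v (parents ?G X)) (v X)"
  have fin: "finite (V - C)"
    using dag by (simp add: dag_def)
  have K_nonneg: "0 \<le> K X (restrict v (parents ?G X)) (v X)" if "X \<in> V - C" "v \<in> ?W" for X v
    using K that restrict_parents_PiE[OF dag_context[of c0], of v D X]
    unfolding kernel_on_def by blast
  have switched: "0 \<le> switched_kernel c0 K c X p x" if "0 \<le> K X p x" for X p x
    using that by (simp add: switched_kernel_def)
  have "\<exists>v \<in> ?W. ?f K v \<noteq> 0"
  proof (rule ccontr)
    assume "\<not> (\<exists>v \<in> ?W. ?f K v \<noteq> 0)"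
    then have "sum (?f K) ?W = 0"
      by (intro sum.neutral) blast
    with pos show False
      unfolding factor_sum_def Diff_empty by simp
  qed
  then obtain v where v: "v \<in> ?W" "?f K v \<noteq> 0"
    by blast
  have "0 < ?f (switched_kernel c0 K c) v"
  proof (rule prod_pos)
    fix X assume X: "X \<in> V - C"
    then have "0 < K X (restrict v (parents ?G X)) (v X)"
      using v fin K_nonneg[OF X v(1)] by (auto simp: order_less_le)
    then show "0 < switched_kernel c0 K c X (restrict v (parents ?G X)) (v X)"
      using X card_domain by (simp add: switched_kernel_def)
  qed
  moreover have "finite ?W"
    using fin finite_domain' by (intro finite_subset[of ?W "PiE (V - C) D"] finite_PiE) auto
  ultimately show ?thesis
    unfolding factor_sum_def Diff_empty
    by (intro sum_pos2[OF _ v(1)]) (auto intro!: prod_nonneg switched K_nonneg)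
qed

text \<open>The limit, as \<epsilon> tends to 0, of the observational distributions of the extended
  models. It vanishes on all other contexts, so in general it is only context positive.\<close>

definition point_context :: "('v \<Rightarrow> 'a) \<Rightarrow> (('v \<Rightarrow> 'a) \<Rightarrow> real) \<Rightarrow> ('v \<Rightarrow> 'a) \<Rightarrow> real" where
  "point_context c0 Q =
     (\<lambda>n \<in> PiE N D. if restrict n C = c0 then Q (restrict n (N - C)) else 0)"

lemma point_context_positive:
  assumes c0: "c0 \<in> PiE C D" and Q: "Q \<in> positive_distributions (N - C) D"
  shows "point_context c0 Q \<in> context_positive_distributions N D C"
proof -
  have rest: "restrict n (N - C) \<in> PiE (N - C) D" if "n \<in> PiE N D" for n
    using that by (auto simp: PiE_iff)
  have Qpos: "0 < Q m" if "m \<in> PiE (N - C) D" for m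
    using Q that by (simp add: positive_distributions_def)
  have nonneg: "0 \<le> point_context c0 Q n" if "n \<in> PiE N D" for n
    using that Qpos[OF rest[OF that]] by (simp add: point_context_def)
  have "(\<Sum>n \<in> PiE N D. point_context c0 Q n) =
      (\<Sum>n \<in> {n \<in> PiE N D. restrict n C = c0}. Q (restrict n (N - C)))"
    by (rule sum.mono_neutral_cong_right) (auto simp: finite_PiE_N point_context_def)
  also have "\<dots> = (\<Sum>m \<in> PiE (N - C) D. Q (restrict (override_on m c0 C) (N - C)))"
    by (rule sum_context[OF CN c0])
  also have "\<dots> = (\<Sum>m \<in> PiE (N - C) D. Q m)"
  proof (rule sum.cong[OF refl])
    fix m assume "m \<in> PiE (N - C) D"
    then have "restrict (override_on m c0 C) (N - C) = m"
      by (auto simp: override_on_def PiE_iff extensional_def fun_eq_iff)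
    then show "Q (restrict (override_on m c0 C) (N - C)) = Q m"
      by simp
  qed
  also have "\<dots> = 1"
    using Q by (simp add: positive_distributions_def distributions_def)
  finally have "point_context c0 Q \<in> distributions N D"
    using nonneg by (auto simp: distributions_def point_context_def)
  moreover have "0 < point_context c0 Q n"
    if n: "n \<in> PiE N D"
      and mass: "0 < (\<Sum>m \<in> {m \<in> PiE N D. restrict m C = restrict n C}. point_context c0 Q m)" for n
  proof -
    have "restrict n C = c0"
    proof (rule ccontr)
      assume "restrict n C \<noteq> c0"
      then have "(\<Sum>m \<in> {m \<in> PiE N D. restrict m C = restrict n C}. point_context c0 Q m) = 0"
        by (intro sum.neutral) (auto simp: point_context_def)
      with mass show False
        by simp
    qed
    then show ?thesis
      using n Qpos[OF rest[OF n]] by (simp add: point_context_def)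
  qed
  ultimately show ?thesis
    by (simp add: context_positive_distributions_def)
qed

lemma continuous_on_point_context: "continuous_on A (point_context c0)"
proof (rule continuous_on_coordinatewise_then_product)
  fix n
  show "continuous_on A (\<lambda>Q. point_context c0 Q n)"
    by (cases "n \<in> PiE N D"; cases "restrict n C = c0")
      (simp_all add: point_context_def continuous_on_evaluation)
qed

text \<open>The operator of the context is \<open>F\<close> after \<open>point_context c0\<close>.
  In general no positive model attains this argument, so the value of \<open>F\<close> there is
  found as a limit along the extended models.\<close>

lemma identifiable_context_if_labelled:
  assumes id: "identifiable_labelled V E N D C L T S" and c0: "c0 \<in> PiE C D"
  shows "identifiable (V - C) (context_edges c0) (N - C) D T S"
  unfolding identifiable_def
proof (intro ballI)
  fix t s assume t: "t \<in> PiE T D" and s: "s \<in> PiE S D"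
  let ?CP = "context_positive_distributions N D C"
  obtain F where F_cont: "continuous_on ?CP F" and
    F_eq: "\<forall>M. is_sem V E D M \<and> compatible E D C L M \<and> (\<forall>n \<in> PiE N D. 0 < obs_dist V E D M N n) \<longrightarrow>
      F (obs_dist V E D M N) = causal_effect V E D M T t S s"
    using id t s unfolding identifiable_labelled_def by blast
  have "continuous_on (positive_distributions (N - C) D) (\<lambda>Q. F (point_context c0 Q))"
    by (rule continuous_on_compose2[OF F_cont continuous_on_point_context])
      (use point_context_positive[OF c0] in blast)
  moreover have "F (point_context c0 (obs_dist (V - C) (context_edges c0) D M (N - C))) =
      causal_effect (V - C) (context_edges c0) D M T t S s"
    if sem: "is_sem (V - C) (context_edges c0) D M"
      and pos: "\<And>m. m \<in> PiE (N - C) D \<Longrightarrow> 0 < obs_dist (V - C) (context_edges c0) D M (N - C) m" for M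
  proof -
    let ?G = "context_edges c0" and ?K = "mech_law M"
    have K: "kernel_on (V - C) ?G D ?K"
      by (rule kernel_on_mech_law[OF sem finite_domain'])
    define M' where "M' \<epsilon> = kernel_sem D (extended_kernel c0 ?K \<epsilon>)" for \<epsilon>
    define w where "w \<epsilon> c = (\<Prod>X\<in>C. (1 - \<epsilon>) * of_bool (c X = c0 X) + \<epsilon> / card (D X))" for \<epsilon> c
    \<comment> \<open>For \<epsilon> strictly between 0 and 1, \<open>q\<close> and \<open>r\<close>
      are the observational distribution and the causal effect of \<open>M' \<epsilon>\<close>. As
      explicit formulas in \<epsilon> they also make sense at 0.\<close>
    define q where "q \<epsilon> = (\<lambda>n \<in> PiE N D. w \<epsilon> n * factor_sum (V - C) ?G D
      (switched_kernel c0 ?K (restrict n C)) {} undefined (N - C) n)" for \<epsilon>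
    define r where "r \<epsilon> = (\<Sum>c \<in> PiE C D. w \<epsilon> c * factor_sum (V - C) ?G D
      (switched_kernel c0 ?K c) T t S s)" for \<epsilon>
    have Fqr: "F (q \<epsilon>) = r \<epsilon>" and q_CP: "q \<epsilon> \<in> ?CP" if \<epsilon>: "0 < \<epsilon>" "\<epsilon> < 1" for \<epsilon>
    proof -
      have KE: "kernel_on V E D (extended_kernel c0 ?K \<epsilon>)"
        using \<epsilon> by (intro kernel_on_extended[OF c0 K]) auto
      have sem': "is_sem V E D (M' \<epsilon>)"
        unfolding M'_def by (rule is_sem_kernel_sem[OF KE finite_domain])
      have comp': "compatible E D C L (M' \<epsilon>)"
        unfolding M'_def by (rule compatible_extended[OF c0])
      note law = mech_law_kernel_sem[OF KE finite_domain, folded M'_def]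
      have factors: "mech_law (M' \<epsilon>) X (restrict v (parents E X)) (v X) =
          switched_kernel c0 ?K c X (restrict v (parents ?G X)) (v X)"
        if "c \<in> PiE C D" "v \<in> PiE V D" "\<And>Z. Z \<in> C \<Longrightarrow> v Z = c Z" "X \<in> V - C" for c v X
      proof -
        have "mech_law (M' \<epsilon>) X (restrict v (parents E X)) (v X) =
            extended_kernel c0 ?K \<epsilon> X (restrict v (parents E X)) (v X)"
          using that by (intro law restrict_parents_PiE[OF dag]) auto
        also have "\<dots> = switched_kernel c0 ?K c X (restrict v (parents ?G X)) (v X)"
          by (rule extended_kernel_factors) (use that in auto)
        finally show ?thesis .
      qed
      have w: "(\<Prod>X\<in>C. mech_law (M' \<epsilon>) X (\<lambda>_. undefined) (c X)) = w \<epsilon> c"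
        if "\<And>X. X \<in> C \<Longrightarrow> c X \<in> D X" for c
        unfolding w_def
      proof (rule prod.cong[OF refl])
        fix X assume X: "X \<in> C"
        then have "mech_law (M' \<epsilon>) X (\<lambda>_. undefined) (c X) =
            extended_kernel c0 ?K \<epsilon> X (\<lambda>_. undefined) (c X)"
          using CV that by (intro law) (auto simp: roots)
        then show "mech_law (M' \<epsilon>) X (\<lambda>_. undefined) (c X) =
            (1 - \<epsilon>) * of_bool (c X = c0 X) + \<epsilon> / card (D X)"
          using X by (simp add: extended_kernel_def)
      qed
      have w_pos: "0 < w \<epsilon> c" for c
        unfolding w_def using \<epsilon> card_domain CV
        by (intro prod_pos add_nonneg_pos) auto
      have obs: "obs_dist V E D (M' \<epsilon>) N = q \<epsilon>"
      proof (rule extensionalityI[where A = "PiE N D"])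
        fix n assume n: "n \<in> PiE N D"
        have "obs_dist V E D (M' \<epsilon>) N n = (\<Prod>X\<in>C. mech_law (M' \<epsilon>) X (\<lambda>_. undefined) (n X)) *
            factor_sum (V - C) ?G D (switched_kernel c0 ?K (restrict n C)) {} undefined (N - C) n"
          by (rule obs_dist_mixture[where E' = "\<lambda>_. ?G" and K' = "switched_kernel c0 ?K",
                OF sem' context_edges_subset factors n])
        also have "(\<Prod>X\<in>C. mech_law (M' \<epsilon>) X (\<lambda>_. undefined) (n X)) = w \<epsilon> n"
          using n CN by (intro w) auto
        finally show "obs_dist V E D (M' \<epsilon>) N n = q \<epsilon> n"
          using n by (simp add: q_def restrict_def)
      qed (auto simp: obs_dist_def q_def)
      have q_pos: "0 < q \<epsilon> n" if n: "n \<in> PiE N D" for n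
      proof -
        have m: "restrict n (N - C) \<in> PiE (N - C) D"
          using n by (auto simp: PiE_iff)
        have "0 < factor_sum (V - C) ?G D ?K {} undefined (N - C) (restrict n (N - C))"
          using pos[OF m] by (simp add: obs_dist_eq_factor_sum[OF dag_context sem finite_domain' m])
        also have "factor_sum (V - C) ?G D ?K {} undefined (N - C) (restrict n (N - C)) =
            factor_sum (V - C) ?G D ?K {} undefined (N - C) n"
          by (rule factor_sum_cong[OF dag_context]) auto
        finally show ?thesis
          using n w_pos by (simp add: q_def switched_factor_sum_pos[OF K])
      qed
      have "causal_effect V E D (M' \<epsilon>) T t S s =
          (\<Sum>c \<in> PiE C D. (\<Prod>X\<in>C. mech_law (M' \<epsilon>) X (\<lambda>_. undefined) (c X)) *
            factor_sum (V - C) ?G D (switched_kernel c0 ?K c) T t S s)"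
        by (rule causal_effect_mixture[where E' = "\<lambda>_. ?G" and K' = "switched_kernel c0 ?K",
              OF sem' context_edges_subset factors t])
      also have "\<dots> = r \<epsilon>"
        unfolding r_def by (intro sum.cong refl arg_cong2[where f = "(*)"] w) auto
      finally have eff: "causal_effect V E D (M' \<epsilon>) T t S s = r \<epsilon>" .
      show "F (q \<epsilon>) = r \<epsilon>"
        using F_eq[rule_format, of "M' \<epsilon>"] sem' comp' q_pos by (simp add: obs eff)
      have "q \<epsilon> \<in> distributions N D"
        using obs_dist_distribution[OF dag sem' finite_domain N] by (simp add: obs)
      then show "q \<epsilon> \<in> ?CP"
        using q_pos by (simp add: context_positive_distributions_def)
    qed
    \<comment> \<open>At 0 the weight is the indicator of \<open>c0\<close>, so \<open>q 0\<close>
      and \<open>r 0\<close> retain only the context where the switched kernel is the kernel of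
      \<open>M\<close>.\<close>
    have w0: "w 0 n = of_bool (restrict n C = c0)" for n
    proof (cases "\<forall>X\<in>C. n X = c0 X")
      case True
      then have "restrict n C = c0"
        using c0 by (auto simp: PiE_iff extensional_def fun_eq_iff)
      with True show ?thesis
        by (simp add: w_def)
    next
      case False
      then have "w 0 n = 0"
        using dag CV unfolding w_def
        by (intro prod_zero) (auto simp: dag_def intro: finite_subset)
      with False show ?thesis
        by auto
    qed
    have switched0: "switched_kernel c0 ?K c0 = ?K"
      by (simp add: switched_kernel_def fun_eq_iff)
    have q0: "q 0 = point_context c0 (obs_dist (V - C) ?G D M (N - C))"
    proof (rule extensionalityI[where A = "PiE N D"])
      fix n assume n: "n \<in> PiE N D"
      then have m: "restrict n (N - C) \<in> PiE (N - C) D"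
        by (auto simp: PiE_iff)
      have "factor_sum (V - C) ?G D ?K {} undefined (N - C) n =
          factor_sum (V - C) ?G D ?K {} undefined (N - C) (restrict n (N - C))"
        by (rule factor_sum_cong[OF dag_context]) auto
      then show "q 0 n = point_context c0 (obs_dist (V - C) ?G D M (N - C)) n"
        using n by (simp add: q_def point_context_def w0 switched0
            obs_dist_eq_factor_sum[OF dag_context sem finite_domain' m])
    qed (auto simp: q_def point_context_def)
    have "r 0 = (\<Sum>c \<in> PiE C D. if c = c0 then
        factor_sum (V - C) ?G D (switched_kernel c0 ?K c) T t S s else 0)"
      unfolding r_def
      by (intro sum.cong refl) (auto simp: w0 PiE_iff extensional_restrict)
    also have "\<dots> = factor_sum (V - C) ?G D ?K T t S s"
      by (simp add: finite_PiE_C c0 switched0)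
    also have "\<dots> = causal_effect (V - C) ?G D M T t S s"
      using t TV
      by (intro causal_effect_eq_factor_sum[OF dag_context sem finite_domain', symmetric]) auto
    finally have r0: "r 0 = causal_effect (V - C) ?G D M T t S s" .
    have "obs_dist (V - C) ?G D M (N - C) \<in> positive_distributions (N - C) D"
      using pos obs_dist_distribution[OF dag_context sem finite_domain' NV]
      by (simp add: positive_distributions_def)
    then have q0_CP: "q 0 \<in> ?CP"
      unfolding q0 by (rule point_context_positive[OF c0])
    have w_cont: "continuous_on A (\<lambda>\<epsilon>. w \<epsilon> c)" for A c
    proof -
      have "continuous_on A (\<lambda>\<epsilon>. (1 - \<epsilon>) * of_bool (c X = c0 X) + \<epsilon> / card (D X))" if "X \<in> C" for X
        using card_domain[of X] CV that by (intro continuous_intros) auto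
      then show ?thesis
        unfolding w_def by (intro continuous_on_prod)
    qed
    have q_cont: "continuous_on {0..<1} q"
    proof (rule continuous_on_coordinatewise_then_product)
      fix n
      show "continuous_on {0..<1} (\<lambda>\<epsilon>. q \<epsilon> n)"
        by (cases "n \<in> PiE N D") (auto simp: q_def intro!: continuous_intros w_cont)
    qed
    have q_CP': "q ` {0..<1} \<subseteq> ?CP"
      using q_CP q0_CP by (force simp: order_le_less)
    have Fq_cont: "continuous_on {0..<1} (\<lambda>\<epsilon>. F (q \<epsilon>))"
      by (rule continuous_on_compose2[OF F_cont q_cont q_CP'])
    have r_cont: "continuous_on {0..<1} r"
      unfolding r_def by (intro continuous_intros w_cont)
    \<comment> \<open>The double successor keeps the first term below 1, inside the range where
      \<open>Fqr\<close> holds.\<close>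
    let ?e = "\<lambda>k. inverse (real (Suc (Suc k)))"
    have e: "?e \<longlonglongrightarrow> 0" "\<And>k. 0 < ?e k" "\<And>k. ?e k < 1"
      using LIMSEQ_Suc[OF LIMSEQ_inverse_real_of_nat] by (auto simp: field_simps)
    have "(\<lambda>k. F (q (?e k))) \<longlonglongrightarrow> F (q 0)"
      using e by (intro continuous_on_tendsto_compose[OF Fq_cont]) (auto intro!: always_eventually less_imp_le)
    moreover have "(\<lambda>k. r (?e k)) \<longlonglongrightarrow> r 0"
      using e by (intro continuous_on_tendsto_compose[OF r_cont]) (auto intro!: always_eventually less_imp_le)
    ultimately have "F (q 0) = r 0"
      using Fqr[OF e(2,3)] LIMSEQ_unique by simp
    then show ?thesis
      by (simp add: q0 r0)
  qed
  ultimately show "\<exists>F. continuous_on (positive_distributions (N - C) D) F \<and>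
    (\<forall>M. is_sem (V - C) (context_edges c0) D M \<and>
        (\<forall>n \<in> PiE (N - C) D. 0 < obs_dist (V - C) (context_edges c0) D M (N - C) n) \<longrightarrow>
      F (obs_dist (V - C) (context_edges c0) D M (N - C)) =
        causal_effect (V - C) (context_edges c0) D M T t S s)"
    by blast
qed

end

theorem theorem1:
  fixes V N C T S :: "'v set"
    and E :: "('v \<times> 'v) set"
    and D :: "'v \<Rightarrow> 'a set"
    and L :: "('v \<Rightarrow> 'a) \<Rightarrow> ('v \<times> 'v) set"
  assumes "dag V E"
    and "N \<subseteq> V"
    and "\<And>X. X \<in> V \<Longrightarrow> finite (D X) \<and> D X \<noteq> {}"
    and "C \<subseteq> observed_roots E N"
    and "T \<subseteq> N - C" and "S \<subseteq> N - C" and "T \<inter> S = {}"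
    and "label_set V E D C L"
    and "maximal_regular E D C L"
  shows "identifiable_labelled V E N D C L T S \<longleftrightarrow>
    (\<forall>c \<in> PiE C D.
       identifiable (V - C) (E \<inter> ((V - C) \<times> (V - C)) - L c) (N - C) D T S)"
proof -
  have "(Y, X) \<in> E \<and> X \<notin> C \<and> Y \<notin> C" if "c \<in> PiE C D" "(Y, X) \<in> L c" for c X Y
  proof -
    have "L c \<subseteq> E" "\<forall>(Y, X) \<in> L c. X \<notin> C \<and> Y \<notin> C"
      using assms(8) that(1) unfolding label_set_def by (simp, simp add: case_prod_unfold)
    with that(2) show ?thesis
      by auto
  qed
  moreover have "maximal_labels E D C L"
    using assms(9) by (simp add: maximal_regular_def)
  ultimately interpret labelled_graph V N C T S E D L
    using assms(1-6) by unfold_locales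
  show ?thesis
    using identifiable_labelled_if_contexts identifiable_context_if_labelled
    unfolding context_edges_def by blast
qed

end
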